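(* For any two integers $n,m\geq 9$ with $n\equiv m\equiv 2 \pmod 7$, $$\gamma^{\infty}_{all}(P_m\boxtimes P_n)\leq \frac{mn}{7}+\frac{8}{7}(m+n-1).$$
   Context: $P_m\boxtimes P_n$ is the strong grid: vertex set $\{0,\dots,m-1\}\times\{0,\dots,n-1\}$, with $(i_1,j_1)$ adjacent to $(i_2,j_2)$ iff $\max\{|i_1-i_2|,|j_1-j_2|\}=1$. Eternal domination game (all-guards-move model): $k$ guards are placed on distinct vertices of a graph $G$ forming a dominating set; at each turn an attacker chooses a vertex, and then every guard may stay in place or move to an adjacent vertex, with no two guards ending on the same vertex, and some guard must end on the attacked vertex. $\gamma^{\infty}_{all}(G)$ is the minimum $k$ such that $k$ guards have a strategy to do this against every infinite sequence of attacks. *)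

theory Defs
  imports Complex_Main
begin

text \<open>A graph is given by a vertex set V and a symmetric adjacency relation adj.\<close>

definition dominating :: "'a set \<Rightarrow> ('a \<Rightarrow> 'a \<Rightarrow> bool) \<Rightarrow> 'a set \<Rightarrow> bool" where
  "dominating V adj D \<longleftrightarrow> D \<subseteq> V \<and> (\<forall>v\<in>V. v \<in> D \<or> (\<exists>u\<in>D. adj u v))"

definition guard_move :: "('a \<Rightarrow> 'a \<Rightarrow> bool) \<Rightarrow> 'a set \<Rightarrow> 'a set \<Rightarrow> bool" where
  "guard_move adj D D' \<longleftrightarrow> (\<exists>f. bij_betw f D D' \<and> (\<forall>x\<in>D. f x = x \<or> adj x (f x)))"

text \<open>k guards have a winning strategy: a strategy assigns to every finite history of
  attacks the current guard configuration; it starts from a dominating set of k distinct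
  vertices and answers every attack by a legal all-guards move that puts a guard on the
  attacked vertex. This covers every infinite attack sequence.\<close>
definition eternal_all_win :: "'a set \<Rightarrow> ('a \<Rightarrow> 'a \<Rightarrow> bool) \<Rightarrow> nat \<Rightarrow> bool" where
  "eternal_all_win V adj k \<longleftrightarrow>
     (\<exists>S :: 'a list \<Rightarrow> 'a set.
        dominating V adj (S []) \<and>
        (\<forall>as \<in> lists V. finite (S as) \<and> S as \<subseteq> V \<and> card (S as) = k) \<and>
        (\<forall>as \<in> lists V. \<forall>v \<in> V. guard_move adj (S as) (S (as @ [v])) \<and> v \<in> S (as @ [v])))"

definition eternal_dom_all :: "'a set \<Rightarrow> ('a \<Rightarrow> 'a \<Rightarrow> bool) \<Rightarrow> nat" where
  "eternal_dom_all V adj = (LEAST k. eternal_all_win V adj k)"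

definition grid_vertices :: "nat \<Rightarrow> nat \<Rightarrow> (nat \<times> nat) set" where
  "grid_vertices m n = {0..<m} \<times> {0..<n}"

definition strong_adj :: "nat \<times> nat \<Rightarrow> nat \<times> nat \<Rightarrow> bool" where
  "strong_adj p q \<longleftrightarrow>
     max \<bar>int (fst p) - int (fst q)\<bar> \<bar>int (snd p) - int (snd q)\<bar> = 1"

end

theory Submission
  imports Defs
begin

text \<open>Write m = 7a + 2 and n = 7b + 2. The four corners are always guarded, each of the 2(a + b)
  blocks of seven further border cells carries five guards, and the guards in the inner
  7a by 7b box form one of the sublattices x + 2y = t or x - 2y = s modulo 7; this makes
  7ab + 10(a + b) + 4 guards. An attack on an inner cell v is answered by switching to the lattice
  of the other slope through v: in the infinite plane this switch is a bijection by king moves whose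
  flow across every grid line balances within each period of seven. A guard that would leave the
  box enters the border next to it, and the border guards of the block pass it on to the cell
  where the lattice needs a new guard. Only for four pairs (t, s) does a guard want to leave the box
  diagonally through a corner; there the border guards along two sides all pass on their guards to the
  neighbouring block, around the corner between these sides. An attack on a border cell is answered
  inside its block.\<close>

section \<open>Guard moves\<close>

text \<open>Translating the lattice by one king step would also bring a guard to any inner cell, but
  it sends a net flow of one guard per period through at least one pair of opposite sides, which the
  border would have to carry back around the box. Changing the slope avoids this. On the cells with
  x + 2y = t modulo 7 the residue r = s - (x - 2y) equals s + t - 2x and also s - t + 4y, so dx
  depends on the column alone and dy on the row alone. The tables for dx and dy make certain
  adjacent columns trade places as a whole, and likewise certain adjacent rows. The switch is
  therefore a product of two involutions, and each crossing of a grid line is matched by one in the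
  other direction. Since both dimensions of the box are multiples of 7, opposite sides are crossed
  together or not at all. What remains is a finite question about one block: for all rows S and T in
  1..7, five border guards must turn a departure at S into an arrival at T and end in a pattern that
  fits T.\<close>

definition near :: "int \<times> int \<Rightarrow> int \<times> int \<Rightarrow> bool" where
  "near p q \<longleftrightarrow> \<bar>fst p - fst q\<bar> \<le> 1 \<and> \<bar>snd p - snd q\<bar> \<le> 1"

definition king_move :: "(int \<times> int) set \<Rightarrow> (int \<times> int) set \<Rightarrow> bool" where
  "king_move D D' \<longleftrightarrow> (\<exists>f. bij_betw f D D' \<and> (\<forall>x\<in>D. near x (f x)))"

lemma king_move_refl: "king_move D D"
  unfolding king_move_def near_def by (rule exI[of _ id]) (auto simp: bij_betw_def)

lemma king_move_UN:
  assumes king_move: "\<And>i. i \<in> I \<Longrightarrow> king_move (A i) (B i)"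
    and dA: "\<And>i j. i \<in> I \<Longrightarrow> j \<in> I \<Longrightarrow> i \<noteq> j \<Longrightarrow> A i \<inter> A j = {}"
    and dB: "\<And>i j. i \<in> I \<Longrightarrow> j \<in> I \<Longrightarrow> i \<noteq> j \<Longrightarrow> B i \<inter> B j = {}"
  shows "king_move (\<Union>i\<in>I. A i) (\<Union>i\<in>I. B i)"
proof -
  have "\<forall>i\<in>I. \<exists>f. bij_betw f (A i) (B i) \<and> (\<forall>x\<in>A i. near x (f x))"
    using king_move unfolding king_move_def by blast
  then obtain F where F: "\<And>i. i \<in> I \<Longrightarrow> bij_betw (F i) (A i) (B i)"
    "\<And>i x. i \<in> I \<Longrightarrow> x \<in> A i \<Longrightarrow> near x (F i x)" by metis
  define f where "f x = F (THE i. i \<in> I \<and> x \<in> A i) x" for x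
  have the: "(THE i. i \<in> I \<and> x \<in> A i) = i" if "i \<in> I" "x \<in> A i" for i x
    using dA that by (intro the_equality) blast+
  have f: "f x = F i x" if "i \<in> I" "x \<in> A i" for i x
    unfolding f_def by (simp add: the[OF that])
  have bij: "bij_betw f (A i) (B i)" if "i \<in> I" for i
    using F(1)[OF that] f[OF that] by (simp cong: bij_betw_cong)
  have "bij_betw f (\<Union>i\<in>I. A i) (\<Union>i\<in>I. B i)"
    unfolding bij_betw_def
  proof
    show "inj_on f (\<Union>i\<in>I. A i)"
    proof (rule inj_onI)
      fix x y assume "x \<in> (\<Union>i\<in>I. A i)" "y \<in> (\<Union>i\<in>I. A i)" and eq: "f x = f y"
      then obtain i j where ij: "i \<in> I" "x \<in> A i" "j \<in> I" "y \<in> A j" by blast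
      then have "f x \<in> B i" "f y \<in> B j" using bij by (auto simp: bij_betw_def)
      then have "i = j" using dB[of i j] ij eq by auto
      then show "x = y" using ij eq bij[of i] by (auto simp: bij_betw_def inj_on_def)
    qed
    show "f ` (\<Union>i\<in>I. A i) = (\<Union>i\<in>I. B i)"
      using bij by (simp add: image_UN bij_betw_def)
  qed
  moreover have "near x (f x)" if "x \<in> (\<Union>i\<in>I. A i)" for x
    using that F(2) f by (metis UN_E)
  ultimately show ?thesis unfolding king_move_def by blast
qed

text \<open>Old and new guards carry separate labellings, so one cell may belong to different groups
  before and after the move. The diagonal cases need this: there a grid corner is a source for one
  side and a target for another.\<close>

lemma king_move_label:
  assumes "\<And>i. king_move {g \<in> D. lab g = i} {h \<in> D'. lab' h = i}"
  shows "king_move D D'"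
proof -
  have "king_move (\<Union>i\<in>UNIV. {g \<in> D. lab g = i}) (\<Union>i\<in>UNIV. {h \<in> D'. lab' h = i})"
    by (rule king_move_UN) (use assms in auto)
  moreover have "(\<Union>i\<in>UNIV. {g \<in> D. lab g = i}) = D" "(\<Union>i\<in>UNIV. {h \<in> D'. lab' h = i}) = D'"
    by auto
  ultimately show ?thesis by simp
qed

lemma king_move_Un:
  assumes "king_move A B" "king_move C E" "A \<inter> C = {}" "B \<inter> E = {}"
  shows "king_move (A \<union> C) (B \<union> E)"
proof -
  have "king_move (\<Union>i\<in>UNIV. if i then A else C) (\<Union>i\<in>UNIV. if i then B else E)"
    by (rule king_move_UN) (use assms in auto)
  then show ?thesis by (simp add: UNIV_bool Un_commute)
qed

lemma king_move_image:
  assumes "king_move D D'" and iso: "\<And>p q. near (e p) (e q) \<longleftrightarrow> near p q" and "inj e"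
  shows "king_move (e ` D) (e ` D')"
proof -
  obtain f where f: "bij_betw f D D'" "\<forall>x\<in>D. near x (f x)"
    using assms(1) unfolding king_move_def by blast
  have inv: "inv e (e p) = p" for p using \<open>inj e\<close> by simp
  have "bij_betw (e \<circ> f \<circ> inv e) (e ` D) (e ` D')"
  proof (rule bij_betw_trans)
    show "bij_betw (inv e) (e ` D) D"
      by (rule bij_betw_byWitness[of _ e]) (auto simp: inv)
    show "bij_betw (e \<circ> f) D (e ` D')"
      by (rule bij_betw_trans[OF f(1)]) (auto intro: bij_betw_imageI \<open>inj e\<close>[THEN inj_on_subset])
  qed
  then show ?thesis unfolding king_move_def
    by (intro exI[of _ "e \<circ> f \<circ> inv e"]) (use f iso inv in auto)
qed

lemma king_move_list:
  assumes "distinct xs" "distinct ys" "list_all2 near xs ys"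
  shows "king_move (set xs) (set ys)"
proof -
  have len: "length xs = length ys" using assms(3) by (rule list_all2_lengthD)
  define f where "f x = the (map_of (zip xs ys) x)" for x
  have f: "f (xs ! i) = ys ! i" if "i < length xs" for i
    using that len assms(1) unfolding f_def by (simp add: map_of_zip_nth)
  have "bij_betw f (set xs) (set ys)"
    unfolding bij_betw_def
  proof
    show "inj_on f (set xs)"
    proof (rule inj_onI)
      fix x y assume "x \<in> set xs" "y \<in> set xs" and eq: "f x = f y"
      then obtain i j where ij: "i < length xs" "x = xs ! i" "j < length xs" "y = xs ! j"
        by (metis in_set_conv_nth)
      then have "ys ! i = ys ! j" using f eq by simp
      then show "x = y" using ij len assms(2) by (simp add: nth_eq_iff_index_eq)
    qed
    show "f ` set xs = set ys"
    proof
      show "f ` set xs \<subseteq> set ys" using f len by (fastforce simp: in_set_conv_nth)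
      show "set ys \<subseteq> f ` set xs"
      proof
        fix y assume "y \<in> set ys"
        then obtain i where "i < length ys" "y = ys ! i" by (auto simp: in_set_conv_nth)
        then show "y \<in> f ` set xs" using f[of i] len by (metis image_eqI nth_mem)
      qed
    qed
  qed
  moreover have "near x (f x)" if "x \<in> set xs" for x
    using that f assms(3) by (auto simp: in_set_conv_nth list_all2_conv_all_nth)
  ultimately show ?thesis unfolding king_move_def by blast
qed

lemma map_insort_key: "map f (insort_key f x xs) = insort (f x) (map f xs)"
  by (induction xs) auto

section \<open>Border blocks\<close>

definition close :: "int list \<Rightarrow> int list \<Rightarrow> bool" where
  "close xs ys \<longleftrightarrow> list_all2 (\<lambda>x y. \<bar>x - y\<bar> \<le> 1) xs ys"

text \<open>Guarded rows of a border block, depending on the row y of the block's inner neighbour that lies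
  on the current lattice. The table is a minimal family, found by a search, that is closed under
  all responses below.\<close>

definition patterns :: "int \<Rightarrow> int list list" where
  "patterns y =
    (if y = 1 then [[1,3,4,5,6],[2,4,5,6,7]]
     else if y = 2 then [[1,4,5,6,7],[2,3,4,5,6]]
     else if y = 3 then [[1,2,4,5,7],[1,3,5,6,7]]
     else if y = 4 then [[1,2,3,5,7],[1,3,4,5,7],[1,3,5,6,7]]
     else if y = 5 then [[1,2,3,5,7],[1,3,4,6,7]]
     else if y = 6 then [[1,2,3,4,7],[2,3,4,5,6]]
     else if y = 7 then [[1,2,3,4,6],[2,3,4,5,7]] else [])"

text \<open>A guard arrives from row S' and one departs to row T'. Matching the guards in order of
  their rows is optimal, hence the sorted lists. Rows 0 and 8, just outside the block, occur when guards
  are handed on between neighbouring blocks.\<close>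

definition exchange :: "int \<Rightarrow> int \<Rightarrow> int \<Rightarrow> int \<Rightarrow> bool" where
  "exchange S T S' T' \<longleftrightarrow>
     (\<forall>xs\<in>set (patterns S). \<exists>ys\<in>set (patterns T). close (insort S' xs) (insort T' ys))"

text \<open>This is the response on a side that no guard crosses. The lattice row next to the side
  still changes from S to T, and the border guards must reach a pattern for T by themselves.\<close>

definition shift :: "int \<Rightarrow> int \<Rightarrow> bool" where
  "shift S T \<longleftrightarrow> (\<forall>xs\<in>set (patterns S). \<exists>ys\<in>set (patterns T). close xs ys)"

lemma row_cases:
  assumes "S \<in> {1..7::int}"
  obtains "S = 1" | "S = 2" | "S = 3" | "S = 4" | "S = 5" | "S = 6" | "S = 7"
  using assms by fastforce

lemma ball_rows: "(\<forall>S\<in>{1..7::int}. P S) \<longleftrightarrow> P 1 \<and> P 2 \<and> P 3 \<and> P 4 \<and> P 5 \<and> P 6 \<and> P 7"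
  by (auto elim: row_cases)

lemma pattern_rows:
  "\<forall>S\<in>{1..7}. \<forall>xs\<in>set (patterns S). distinct xs \<and> set xs \<subseteq> {1..7} \<and> length xs = 5"
  unfolding ball_rows by (simp add: patterns_def)

lemma pattern_nonempty: "\<forall>S\<in>{1..7}. patterns S \<noteq> []"
  unfolding ball_rows by (simp add: patterns_def)

lemma exchange_rows: "\<forall>S\<in>{1..7}. \<forall>T\<in>{1..7}. exchange S T S T"
  unfolding ball_rows exchange_def by (simp add: patterns_def close_def)

lemma shift_rows: "\<forall>S\<in>{1..7}. \<forall>T\<in>{1..7}. shift S T"
  unfolding ball_rows shift_def by (simp add: patterns_def close_def)

text \<open>These are the combinations met in \<open>step_diagonal1\<close> and
  \<open>step_diagonal2\<close>. Row 0 stands for row 7 of the preceding block and row 8 for row 1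
  of the following one; for the outermost block they stand for a corner of the grid.\<close>

lemma exchange_special:
  "exchange 5 1 5 8" "exchange 7 4 0 4" "exchange 1 5 8 5" "exchange 4 1 4 8"
  by (simp_all add: exchange_def patterns_def close_def)

text \<open>The inner guard at row S takes part, which is why S is inserted on both sides. For S = 4
  the border guards alone cannot pass from rows 1,2,3,5,7 to rows 1,3,5,6,7, but the six guards
  together can. The inner cell is occupied again afterwards, so the lattice is preserved.\<close>

lemma pattern_attack:
  "\<forall>S\<in>{1..7}. \<forall>j\<in>{1..7}. \<forall>xs\<in>set (patterns S).
     \<exists>ys\<in>set (patterns S). j \<in> set ys \<and> close (insort S xs) (insort S ys)"
  unfolding ball_rows by (simp add: patterns_def close_def)

text \<open>Reversing a block exchanges rows j and 8 - j, and this lets reflections of the grid act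
  on configurations. Sets are compared because a reflection turns sorted lists around.\<close>

lemma pattern_reflect:
  "\<forall>S\<in>{1..7}. \<forall>xs\<in>set (patterns S). \<exists>ys\<in>set (patterns (8 - S)). set ys = (\<lambda>j. 8 - j) ` set xs"
  unfolding ball_rows by (simp add: patterns_def insert_commute)

lemma distinct_insort_key': "distinct (insort_key f x xs) \<longleftrightarrow> x \<notin> set xs \<and> distinct xs"
  by (induction xs) (auto simp: set_insort_key)

text \<open>All cells lie at distance 0 or 1 from the side, so the second coordinate never obstructs
  a king move and only the rows have to be matched. Sorting the cells by \<open>fst\<close> makes
  their projections the sorted row lists that \<open>close\<close> compares. An extra cell at
  distance 1 may share its row with a border guard; at distance 0 it has to avoid the
  pattern.\<close>

lemma block_king_move:
  assumes len: "close (insort S' xs) (insort T' ys)"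
    and "distinct xs" "distinct ys" "c \<in> {0,1}" "d \<in> {0,1}"
    and "c = 0 \<Longrightarrow> S' \<notin> set xs" "d = 0 \<Longrightarrow> T' \<notin> set ys"
  shows "king_move (insert (u + S', c) ((\<lambda>j. (u + j, 0)) ` set xs))
            (insert (u + T', d) ((\<lambda>j. (u + j, 0)) ` set ys))"
proof -
  define X where "X = insort_key fst (u + S', c) (map (\<lambda>j. (u + j, 0)) xs)"
  define Y where "Y = insort_key fst (u + T', d) (map (\<lambda>j. (u + j, 0)) ys)"
  have ins: "insort (u + z) (map ((+) u) zs) = map ((+) u) (insort z zs)" for z :: int and zs
    by (induction zs) auto
  have o: "fst \<circ> (\<lambda>j. (u + j, 0::int)) = (+) u" by auto
  have fX: "map fst X = map ((+) u) (insort S' xs)" and fY: "map fst Y = map ((+) u) (insort T' ys)"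
    by (simp_all add: X_def Y_def map_insort_key o ins)
  have sX: "set X = insert (u + S', c) ((\<lambda>j. (u + j, 0)) ` set xs)"
    and sY: "set Y = insert (u + T', d) ((\<lambda>j. (u + j, 0)) ` set ys)"
    by (simp_all add: X_def Y_def set_insort_key)
  have "distinct X" "distinct Y"
    unfolding X_def Y_def distinct_insort_key' using assms
    by (auto simp: distinct_map inj_on_def)
  moreover have "list_all2 near X Y"
  proof -
    have "list_all2 (\<lambda>x y. \<bar>x - y\<bar> \<le> 1) (map fst X) (map fst Y)"
      using len unfolding fX fY close_def by (simp add: list_all2_map1 list_all2_map2)
    then have l: "length X = length Y" and "\<And>i. i < length X \<Longrightarrow> \<bar>fst (X ! i) - fst (Y ! i)\<bar> \<le> 1"
      by (auto simp: list_all2_conv_all_nth)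
    moreover have "\<bar>snd (X ! i) - snd (Y ! i)\<bar> \<le> 1" if "i < length X" for i
      using nth_mem[of i X] nth_mem[of i Y] that l assms(4,5) unfolding sX sY by auto
    ultimately show ?thesis by (simp add: list_all2_conv_all_nth near_def)
  qed
  ultimately show ?thesis using king_move_list[of X Y] sX sY by simp
qed

lemma block_mv_shift:
  assumes len: "close xs ys" and "distinct xs" "distinct ys"
  shows "king_move ((\<lambda>j. (u + j, 0)) ` set xs) ((\<lambda>j. (u + j, 0)) ` set ys)"
  using king_move_list[of "map (\<lambda>j. (u + j, 0)) xs" "map (\<lambda>j. (u + j, 0)) ys"] assms
  by (simp add: close_def list_all2_map1 list_all2_map2 near_def distinct_map inj_on_def)

definition border :: "nat \<Rightarrow> (nat \<Rightarrow> int list) \<Rightarrow> (int \<times> int) set" where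
  "border N \<beta> = (\<Union>k<N. (\<lambda>j. (7 * int k + j, 0)) ` set (\<beta> k))"

lemma block_unique:
  assumes "(i::int) \<in> {1..7}" "j \<in> {1..7}" "7 * int k + i = 7 * int l + j"
  shows "k = l" "i = j"
proof -
  have "1 \<le> i" "i \<le> 7" "1 \<le> j" "j \<le> 7" using assms(1,2) by auto
  then show "k = l" using assms(3) by presburger
  then show "i = j" using assms(3) by simp
qed

lemma block_disjoint:
  assumes "k \<noteq> l" "R \<subseteq> {1..7::int}" "Q \<subseteq> {1..7}"
  shows "(\<lambda>j. (7 * int k + j, 0::int)) ` R \<inter> (\<lambda>j. (7 * int l + j, 0)) ` Q = {}"
proof -
  have False if "j \<in> R" "i \<in> Q" "7 * int k + j = 7 * int l + i" for i j
    using block_unique(1)[of j i k l] that assms by blast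
  then show ?thesis by auto
qed

lemma side_shift:
  assumes S: "S \<in> {1..7}" and T: "T \<in> {1..7}" and "shift S T"
    and \<beta>: "\<And>k. k < N \<Longrightarrow> \<beta> k \<in> set (patterns S)"
  shows "\<exists>\<beta>'. (\<forall>k<N. \<beta>' k \<in> set (patterns T)) \<and> king_move (border N \<beta>) (border N \<beta>')"
proof -
  have "\<forall>k. \<exists>ys. k < N \<longrightarrow> ys \<in> set (patterns T) \<and> close (\<beta> k) ys"
    using \<beta> \<open>shift S T\<close> unfolding shift_def by meson
  then obtain \<beta>' where \<beta>': "\<And>k. k < N \<Longrightarrow> \<beta>' k \<in> set (patterns T) \<and> close (\<beta> k) (\<beta>' k)"
    by metis
  have rows: "set (\<beta> k) \<subseteq> {1..7}" "set (\<beta>' k) \<subseteq> {1..7}" "distinct (\<beta> k)" "distinct (\<beta>' k)"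
    if "k < N" for k
    using that \<beta> \<beta>' pattern_rows S T by blast+
  have "king_move (border N \<beta>) (border N \<beta>')"
    unfolding border_def
  proof (rule king_move_UN)
    show "king_move ((\<lambda>j. (7 * int k + j, 0)) ` set (\<beta> k)) ((\<lambda>j. (7 * int k + j, 0)) ` set (\<beta>' k))"
      if "k \<in> {..<N}" for k
      using that \<beta>' rows by (intro block_mv_shift) auto
  qed (use rows block_disjoint in auto)
  then show ?thesis using \<beta>' by blast
qed

text \<open>Each block performs one exchange, independently of the others. With row 0 or 8 the extra
  cell lies beside a neighbouring block, but it meets no border cell there: either its distance from
  the side is 1, or it has distance 0 and a position outside 1..7N.\<close>

lemma side_exchange:
  assumes S: "S \<in> {1..7}" and T: "T \<in> {1..7}" and "exchange S T S' T'"
    and \<beta>: "\<And>k. k < N \<Longrightarrow> \<beta> k \<in> set (patterns S)"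
    and c: "\<And>k. k < N \<Longrightarrow> c k = 1 \<or> c k = 0 \<and> 7 * int k + S' \<notin> {1..7 * int N}"
    and d: "\<And>k. k < N \<Longrightarrow> d k = 1 \<or> d k = 0 \<and> 7 * int k + T' \<notin> {1..7 * int N}"
  shows "\<exists>\<beta>'. (\<forall>k<N. \<beta>' k \<in> set (patterns T)) \<and>
    king_move (border N \<beta> \<union> (\<lambda>k. (7 * int k + S', c k)) ` {..<N})
       (border N \<beta>' \<union> (\<lambda>k. (7 * int k + T', d k)) ` {..<N})"
proof -
  have "\<forall>k. \<exists>ys. k < N \<longrightarrow> ys \<in> set (patterns T) \<and> close (insort S' (\<beta> k)) (insort T' ys)"
    using \<beta> \<open>exchange S T S' T'\<close> unfolding exchange_def by meson
  then obtain \<beta>' where \<beta>': "\<And>k. k < N \<Longrightarrow> \<beta>' k \<in> set (patterns T) \<and> close (insort S' (\<beta> k)) (insort T' (\<beta>' k))"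
    by metis
  have rows: "set (\<beta> k) \<subseteq> {1..7}" "set (\<beta>' k) \<subseteq> {1..7}" "distinct (\<beta> k)" "distinct (\<beta>' k)"
    if "k < N" for k
    using that \<beta> \<beta>' pattern_rows S T by blast+
  have range: "7 * int k + j \<in> {1..7 * int N}" if "k < N" "j \<in> {1..7}" for k j
    using that by auto
  let ?P = "\<lambda>\<beta> S c k. insert (7 * int k + S, c k :: int) ((\<lambda>j. (7 * int k + j, 0)) ` set (\<beta> k))"
  have dis: "?P \<gamma> R e k \<inter> ?P \<gamma> R e l = {}"
    if *: "k < N" "l < N" "k \<noteq> l" "\<And>k. k < N \<Longrightarrow> set (\<gamma> k) \<subseteq> {1..7}"
      "\<And>k. k < N \<Longrightarrow> e k = 1 \<or> e k = 0 \<and> 7 * int k + R \<notin> {1..7 * int N}" for \<gamma> R e k l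
  proof -
    have "(7 * int k' + R, e k') \<notin> (\<lambda>j. (7 * int l' + j, 0)) ` set (\<gamma> l')"
      if "k' < N" "l' < N" for k' l'
    proof
      assume "(7 * int k' + R, e k') \<in> (\<lambda>j. (7 * int l' + j, 0)) ` set (\<gamma> l')"
      then obtain j where j: "j \<in> set (\<gamma> l')" "7 * int k' + R = 7 * int l' + j" "e k' = 0" by auto
      then have "7 * int l' + j \<in> {1..7 * int N}"
        using range[of l' j] *(4)[of l'] that by blast
      then show False using j *(5)[of k'] that by auto
    qed
    from this[OF *(1,2)] this[OF *(2,1)]
    have "(7 * int k + R, e k) \<notin> (\<lambda>j. (7 * int l + j, 0)) ` set (\<gamma> l)"
      "(7 * int l + R, e l) \<notin> (\<lambda>j. (7 * int k + j, 0)) ` set (\<gamma> k)" by blast+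
    moreover have "(\<lambda>j. (7 * int k + j, 0::int)) ` set (\<gamma> k) \<inter> (\<lambda>j. (7 * int l + j, 0)) ` set (\<gamma> l) = {}"
      using that(1-4) by (intro block_disjoint) auto
    ultimately show ?thesis using that(3) by auto
  qed
  have "king_move (\<Union>k\<in>{..<N}. ?P \<beta> S' c k) (\<Union>k\<in>{..<N}. ?P \<beta>' T' d k)"
  proof (rule king_move_UN)
    show "king_move (?P \<beta> S' c k) (?P \<beta>' T' d k)" if k: "k \<in> {..<N}" for k
    proof (rule block_king_move)
      show "S' \<notin> set (\<beta> k)" if "c k = 0" using c[of k] k that rows(1)[of k] range[of k S'] by auto
      show "T' \<notin> set (\<beta>' k)" if "d k = 0" using d[of k] k that rows(2)[of k] range[of k T'] by auto
    qed (use k \<beta>' rows c[of k] d[of k] in auto)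
    show "?P \<beta> S' c k \<inter> ?P \<beta> S' c l = {}" if "k \<in> {..<N}" "l \<in> {..<N}" "k \<noteq> l" for k l
      by (rule dis) (use that rows c in auto)
    show "?P \<beta>' T' d k \<inter> ?P \<beta>' T' d l = {}" if "k \<in> {..<N}" "l \<in> {..<N}" "k \<noteq> l" for k l
      by (rule dis) (use that rows d in auto)
  qed
  moreover have "(\<Union>k\<in>{..<N}. ?P \<gamma> R e k) = border N \<gamma> \<union> (\<lambda>k. (7 * int k + R, e k)) ` {..<N}" for \<gamma> R e
    unfolding border_def by auto
  ultimately have "king_move (border N \<beta> \<union> (\<lambda>k. (7 * int k + S', c k)) ` {..<N})
       (border N \<beta>' \<union> (\<lambda>k. (7 * int k + T', d k)) ` {..<N})" by metis
  then show ?thesis using \<beta>' by blast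
qed

section \<open>Switching between the two lattices\<close>

text \<open>A guard of the lattice x + 2y = t moves by (step_x r, step_y r), where r = s - (x - 2y). This
  solves dx - 2 dy = r; the choice between the two solutions for r = 1 and r = 6 is forced by
  injectivity. Guards cross the vertical sides of the box exactly if cross_x holds, and the horizontal
  ones exactly if cross_y holds.\<close>

definition step_x :: "int \<Rightarrow> int" where
  "step_x r = (if r mod 7 \<in> {1,4} then -1 else if r mod 7 \<in> {3,6} then 1 else 0)"

definition step_y :: "int \<Rightarrow> int" where
  "step_y r = (if r mod 7 \<in> {1,2,3} then -1 else if r mod 7 \<in> {4,5,6} then 1 else 0)"

definition cross_x :: "int \<Rightarrow> int \<Rightarrow> bool" where
  "cross_x t s \<longleftrightarrow> (s + t) mod 7 \<in> {3, 6}"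

definition cross_y :: "int \<Rightarrow> int \<Rightarrow> bool" where
  "cross_y t s \<longleftrightarrow> (s - t) mod 7 \<in> {4, 5, 6}"

lemma mod7_cases:
  obtains "(r::int) mod 7 = 0" | "r mod 7 = 1" | "r mod 7 = 2" | "r mod 7 = 3"
    | "r mod 7 = 4" | "r mod 7 = 5" | "r mod 7 = 6"
proof -
  have "0 \<le> r mod 7" "r mod 7 < 7" by simp_all
  then show thesis using that by linarith
qed

text \<open>The inverse performs the same exchanges of columns and rows. Given x' - 2y' = s modulo
  7, the residue t - x' - 2y' is s + t - 2x' and also the negative of s - t + 4y'; as
  \<open>step_y\<close> is odd, the inverse subtracts it. Everything depends on r modulo 7 only,
  which leaves seven cases.\<close>

lemma step_lattice:
  fixes x y s t :: int
  assumes "7 dvd x + 2 * y - t"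
  defines "r \<equiv> s - x + 2 * y"
  defines "x' \<equiv> x + step_x r" and "y' \<equiv> y + step_y r"
  shows "7 dvd x' - 2 * y' - s" "x' + step_x (t - x' - 2 * y') = x"
    "y' - step_y (t - x' - 2 * y') = y"
proof -
  obtain j where j: "x + 2 * y - t = 7 * j" using assms(1) by (auto elim: dvdE)
  have q: "(t - (x + u) - 2 * (y + v)) mod 7 = (- u - 2 * v) mod 7" for u v
  proof -
    have "t - (x + u) - 2 * (y + v) = (- u - 2 * v) + (- j) * 7" using j by simp
    then show ?thesis by (metis mod_mult_self1)
  qed
  have p: "7 dvd (x + u) - 2 * (y + v) - s \<longleftrightarrow> 7 dvd (u - 2 * v - r mod 7)" for u v
  proof -
    obtain k m where km: "r = 7 * k + m" "r mod 7 = m" by (metis mult_div_mod_eq)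
    have "(x + u) - 2 * (y + v) - s = (u - 2 * v - m) - k * 7"
      using km(1) unfolding r_def by (simp add: algebra_simps)
    then show ?thesis unfolding km(2) by (metis dvd_diff_left_iff dvd_triv_right)
  qed
  have "7 dvd x' - 2 * y' - s \<and> x' + step_x (t - x' - 2 * y') = x \<and> y' - step_y (t - x' - 2 * y') = y"
    unfolding x'_def y'_def p step_x_def step_y_def q
    by (cases rule: mod7_cases[of r]; simp)
  then show "7 dvd x' - 2 * y' - s" "x' + step_x (t - x' - 2 * y') = x"
    "y' - step_y (t - x' - 2 * y') = y" by blast+
qed

definition bulk_range :: "int \<Rightarrow> bool \<Rightarrow> int \<Rightarrow> bool" where
  "bulk_range N c x \<longleftrightarrow> 1 \<le> x \<and> x \<le> 7 * N \<and> \<not> (c \<and> (x = 1 \<or> x = 7 * N))"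

lemma mod7_shift: "((r::int) + c + 7 * k) mod 7 = (r mod 7 + c) mod 7"
  by (simp add: mod_simps)

text \<open>Since s + t = r + 2x modulo 7, leaving the box at x = 1 means r in {1,4}, hence s + t in
  {3,6}, which is \<open>cross_x\<close>; leaving it at x = 7N means r in {3,6} and again s + t in
  {3,6}. Stepping from x = 2 or x = 7N - 1 into a removed line would put s + t in {1,4,5}, so this
  does not happen on crossed sides.\<close>

lemma step_x_range:
  fixes x y s t :: int
  assumes xy: "7 dvd x + 2 * y - t" and x: "bulk_range N (cross_x t s) x"
  shows "bulk_range N (cross_x t s) (x + step_x (s - x + 2 * y))"
proof -
  define r where "r = s - x + 2 * y"
  have "s + t = (r + 2 * x) - (x + 2 * y - t)" unfolding r_def by simp
  then have key: "(s + t) mod 7 = (r + 2 * x) mod 7"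
    using xy by (metis mod_diff_right_eq diff_zero dvd_imp_mod_0)
  have "r + 2 * 1 = r + 2 + 7 * 0" "r + 2 * 2 = r + 4 + 7 * 0"
    "r + 2 * (7 * N) = r + 0 + 7 * (2 * N)" "r + 2 * (7 * N - 1) = r + (-2) + 7 * (2 * N)" by simp_all
  then have shifts: "(r + 2 * 1) mod 7 = (r mod 7 + 2) mod 7" "(r + 2 * 2) mod 7 = (r mod 7 + 4) mod 7"
    "(r + 2 * (7 * N)) mod 7 = (r mod 7 + 0) mod 7" "(r + 2 * (7 * N - 1)) mod 7 = (r mod 7 + (-2)) mod 7"
    by (simp_all only: mod7_shift)
  have ends:
    "step_x r = -1 \<Longrightarrow> x = 1 \<Longrightarrow> cross_x t s" "step_x r = 1 \<Longrightarrow> x = 7 * N \<Longrightarrow> cross_x t s"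
    "step_x r = -1 \<Longrightarrow> x = 2 \<Longrightarrow> \<not> cross_x t s" "step_x r = 1 \<Longrightarrow> x = 7 * N - 1 \<Longrightarrow> \<not> cross_x t s"
    unfolding cross_x_def key step_x_def
    by (hypsubst, unfold shifts, cases rule: mod7_cases[of r]; simp)+
  have "step_x r = 1 \<or> step_x r = 0 \<or> step_x r = -1" by (simp add: step_x_def)
  then show ?thesis using ends x unfolding r_def[symmetric] bulk_range_def
    by (cases "cross_x t s") (elim disjE; force)+
qed

lemma step_y_range:
  fixes x y s t :: int
  assumes xy: "7 dvd x + 2 * y - t" and y: "bulk_range N (cross_y t s) y"
  shows "bulk_range N (cross_y t s) (y + step_y (s - x + 2 * y))"
proof -
  define r where "r = s - x + 2 * y"
  have "s - t = (r - 4 * y) + (x + 2 * y - t)" unfolding r_def by simp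
  then have key: "(s - t) mod 7 = (r - 4 * y) mod 7"
    using xy by (metis mod_add_right_eq add_0_right dvd_imp_mod_0)
  have "r - 4 * 1 = r + (-4) + 7 * 0" "r - 4 * 2 = r + (-8) + 7 * 0"
    "r - 4 * (7 * N) = r + 0 + 7 * (-4 * N)" "r - 4 * (7 * N - 1) = r + 4 + 7 * (-4 * N)" by simp_all
  then have shifts: "(r - 4 * 1) mod 7 = (r mod 7 + (-4)) mod 7" "(r - 4 * 2) mod 7 = (r mod 7 + (-8)) mod 7"
    "(r - 4 * (7 * N)) mod 7 = (r mod 7 + 0) mod 7" "(r - 4 * (7 * N - 1)) mod 7 = (r mod 7 + 4) mod 7"
    by (simp_all only: mod7_shift)
  have ends:
    "step_y r = -1 \<Longrightarrow> y = 1 \<Longrightarrow> cross_y t s" "step_y r = 1 \<Longrightarrow> y = 7 * N \<Longrightarrow> cross_y t s"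
    "step_y r = -1 \<Longrightarrow> y = 2 \<Longrightarrow> \<not> cross_y t s" "step_y r = 1 \<Longrightarrow> y = 7 * N - 1 \<Longrightarrow> \<not> cross_y t s"
    unfolding cross_y_def key step_y_def
    by (hypsubst, unfold shifts, cases rule: mod7_cases[of r]; simp)+
  have "step_y r = 1 \<or> step_y r = 0 \<or> step_y r = -1" by (simp add: step_y_def)
  then show ?thesis using ends y unfolding r_def[symmetric] bulk_range_def
    by (cases "cross_y t s") (elim disjE; force)+
qed

section \<open>Configurations\<close>

datatype side = Lft | Bot | Rgt | Top

locale grid =
  fixes a b :: nat
  assumes a_pos: "0 < a" and b_pos: "0 < b"
begin

definition W :: int where "W = 7 * int a + 1"
definition H :: int where "H = 7 * int b + 1"
definition V :: "(int \<times> int) set" where "V = {0..W} \<times> {0..H}"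
definition K :: "(int \<times> int) set" where "K = {0,W} \<times> {0,H}"
definition I :: "(int \<times> int) set" where "I = {1..7 * int a} \<times> {1..7 * int b}"

text \<open>Side coordinates: position along the side, from 0 to 7 len q + 1, and distance from it.\<close>

primrec emb :: "side \<Rightarrow> int \<times> int \<Rightarrow> int \<times> int" where
  "emb Lft p = (snd p, fst p)"
| "emb Bot p = p"
| "emb Rgt p = (W - snd p, fst p)"
| "emb Top p = (fst p, H - snd p)"

primrec len :: "side \<Rightarrow> nat" where
  "len Lft = b" | "len Bot = a" | "len Rgt = b" | "len Top = a"

definition lattice :: "int \<Rightarrow> int \<Rightarrow> (int \<times> int) set" where
  "lattice \<epsilon> t = {p \<in> I. 7 dvd fst p + 2 * \<epsilon> * snd p - t}"

text \<open>This is the lattice congruence at the inner neighbour of row j of a block, with W and H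
  congruent to 1 modulo 7. The number of the block has dropped out: all blocks of a side see the
  lattice in the same row.\<close>

primrec row :: "int \<Rightarrow> int \<Rightarrow> side \<Rightarrow> int \<Rightarrow> bool" where
  "row \<epsilon> t Lft j \<longleftrightarrow> 7 dvd 2 * \<epsilon> * j - (t - 1)"
| "row \<epsilon> t Bot j \<longleftrightarrow> 7 dvd j - (t - 2 * \<epsilon>)"
| "row \<epsilon> t Rgt j \<longleftrightarrow> 7 dvd 2 * \<epsilon> * j - t"
| "row \<epsilon> t Top j \<longleftrightarrow> 7 dvd j - t"

text \<open>The row S is read off from D rather than computed by \<open>row\<close>, so that
  reflecting a configuration or changing a single block involves no residues of rows. The link to
  \<open>row\<close> is recovered in \<open>config_border\<close>.\<close>

definition config :: "int \<Rightarrow> int \<Rightarrow> (int \<times> int) set \<Rightarrow> bool" where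
  "config \<epsilon> t D \<longleftrightarrow> D \<subseteq> V \<and> K \<subseteq> D \<and> D \<inter> I = lattice \<epsilon> t \<and>
     (\<forall>q. \<forall>k<len q. \<exists>S\<in>{1..7}. emb q (7 * int k + S, 1) \<in> D \<and>
        (\<exists>xs\<in>set (patterns S). \<forall>j\<in>{1..7}. emb q (7 * int k + j, 0) \<in> D \<longleftrightarrow> j \<in> set xs))"

lemma inj_emb: "inj (emb q)"
  by (cases q) (auto simp: inj_def)

lemma near_emb: "near (emb q p) (emb q p') \<longleftrightarrow> near p p'"
  by (cases q) (auto simp: near_def)

lemma coord:
  assumes "i \<in> {1..7 * int N}"
  obtains k j where "k < N" "j \<in> {1..7}" "i = 7 * int k + j"
proof
  show "nat ((i - 1) div 7) < N" "(i - 1) mod 7 + 1 \<in> {1..7}"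
    "i = 7 * int (nat ((i - 1) div 7)) + ((i - 1) mod 7 + 1)"
    using assms by (auto simp: pos_imp_zdiv_nonneg_iff)
qed

definition edge :: "side \<Rightarrow> (int \<times> int) set" where
  "edge q = emb q ` ({1..7 * int (len q)} \<times> {0})"

lemma edge_simps:
  "p \<in> edge Lft \<longleftrightarrow> fst p = 0 \<and> 1 \<le> snd p \<and> snd p \<le> 7 * int b"
  "p \<in> edge Bot \<longleftrightarrow> snd p = 0 \<and> 1 \<le> fst p \<and> fst p \<le> 7 * int a"
  "p \<in> edge Rgt \<longleftrightarrow> fst p = W \<and> 1 \<le> snd p \<and> snd p \<le> 7 * int b"
  "p \<in> edge Top \<longleftrightarrow> snd p = H \<and> 1 \<le> fst p \<and> fst p \<le> 7 * int a"
  unfolding edge_def by (cases p; force simp: image_iff)+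

lemma V_cases:
  assumes "p \<in> V"
  obtains "p \<in> K" | "p \<in> I" | q where "p \<in> edge q"
proof -
  have "p \<in> K \<or> p \<in> I \<or> p \<in> edge Lft \<or> p \<in> edge Bot \<or> p \<in> edge Rgt \<or> p \<in> edge Top"
  proof (cases p)
    case (Pair x y)
    have "x = 0 \<or> x = W \<or> 1 \<le> x \<and> x \<le> 7 * int a" "y = 0 \<or> y = H \<or> 1 \<le> y \<and> y \<le> 7 * int b"
      using assms unfolding Pair V_def W_def H_def by auto
    then show ?thesis unfolding Pair edge_simps K_def I_def by (elim disjE; simp)
  qed
  then show thesis using that by blast
qed

lemma edge_disjoint: "q \<noteq> q' \<Longrightarrow> p \<in> edge q \<Longrightarrow> p \<notin> edge q'"
  using a_pos b_pos by (cases q; cases q') (auto simp: edge_simps W_def H_def)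

lemma edge_KI: "p \<in> edge q \<Longrightarrow> p \<notin> K \<and> p \<notin> I"
  by (cases q; cases p) (auto simp: edge_simps K_def I_def W_def H_def)

lemma KI_disjoint: "K \<inter> I = {}"
  by (auto simp: K_def I_def W_def H_def)

lemma subset_V: "K \<subseteq> V" "I \<subseteq> V" "edge q \<subseteq> V"
  by (cases q; auto simp: edge_simps K_def I_def V_def W_def H_def)+

lemma lattice_I: "lattice \<epsilon> t \<subseteq> I"
  by (auto simp: lattice_def)

lemma border_edge:
  assumes "\<And>k. k < len q \<Longrightarrow> set (\<beta> k) \<subseteq> {1..7}"
  shows "emb q ` border (len q) \<beta> \<subseteq> edge q"
proof -
  have "border (len q) \<beta> \<subseteq> {1..7 * int (len q)} \<times> {0}"
    unfolding border_def using assms by fastforce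
  then show ?thesis unfolding edge_def by blast
qed

lemma border_iff:
  assumes "\<And>k. k < len q \<Longrightarrow> set (\<beta> k) \<subseteq> {1..7}" "k < len q" "j \<in> {1..7}"
  shows "emb q (7 * int k + j, 0) \<in> emb q ` border (len q) \<beta> \<longleftrightarrow> j \<in> set (\<beta> k)"
proof -
  have "(7 * int k + j, 0) \<in> border (len q) \<beta> \<longleftrightarrow> j \<in> set (\<beta> k)"
  proof
    assume "(7 * int k + j, 0) \<in> border (len q) \<beta>"
    then obtain l i where li: "l < len q" "i \<in> set (\<beta> l)" "7 * int k + j = 7 * int l + i"
      unfolding border_def by auto
    have "i \<in> {1..7}" using assms(1) li by blast
    from block_unique[OF assms(3) this li(3)] show "j \<in> set (\<beta> k)" using li by simp
  qed (use assms(2) in \<open>auto simp: border_def\<close>)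
  then show ?thesis by (simp add: inj_image_mem_iff[OF inj_emb])
qed

lemma emb_edge: "k < len q \<Longrightarrow> j \<in> {1..7} \<Longrightarrow> emb q (7 * int k + j, 0) \<in> edge q"
  unfolding edge_def by (rule imageI) auto

lemma edge_coord:
  assumes "p \<in> edge q"
  obtains k j where "k < len q" "j \<in> {1..7}" "p = emb q (7 * int k + j, 0)"
proof -
  obtain i where i: "i \<in> {1..7 * int (len q)}" "p = emb q (i, 0)"
    using assms unfolding edge_def by auto
  then show thesis using that by (metis coord)
qed

lemma emb_I:
  assumes "k < len q" "j \<in> {1..7}"
  shows "emb q (7 * int k + j, 1) \<in> I"
proof -
  have "7 * int k + j \<in> {1..7 * int (len q)}" using assms by auto
  then show ?thesis using a_pos b_pos by (cases q) (auto simp: I_def W_def H_def)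
qed

lemma lattice_row:
  assumes "k < len q" "j \<in> {1..7}"
  shows "emb q (7 * int k + j, 1) \<in> lattice \<epsilon> t \<longleftrightarrow> row \<epsilon> t q j"
proof -
  have *: "7 dvd u \<longleftrightarrow> 7 dvd v" if "u = v + 7 * w" for u v w :: int
    using that by (simp add: dvd_add_left_iff)
  have "emb q (7 * int k + j, 1) \<in> I" using emb_I assms .
  then have "emb q (7 * int k + j, 1) \<in> lattice \<epsilon> t \<longleftrightarrow>
    7 dvd fst (emb q (7 * int k + j, 1)) + 2 * \<epsilon> * snd (emb q (7 * int k + j, 1)) - t"
    by (simp add: lattice_def)
  also have "\<dots> \<longleftrightarrow> row \<epsilon> t q j"
  proof (cases q)
    case Lft show ?thesis unfolding Lft emb.simps row.simps fst_conv snd_conv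
      by (rule *[of _ _ "2 * \<epsilon> * int k"]) (simp add: algebra_simps)
  next
    case Bot show ?thesis unfolding Bot emb.simps row.simps fst_conv snd_conv
      by (rule *[of _ _ "int k"]) (simp add: algebra_simps)
  next
    case Rgt show ?thesis unfolding Rgt emb.simps row.simps fst_conv snd_conv W_def
      by (rule *[of _ _ "2 * \<epsilon> * int k + int a"]) (simp add: algebra_simps)
  next
    case Top show ?thesis unfolding Top emb.simps row.simps fst_conv snd_conv H_def
      by (rule *[of _ _ "int k + 2 * \<epsilon> * int b"]) (simp add: algebra_simps)
  qed
  finally show ?thesis .
qed

lemma dvd_unit_exists: "\<exists>j\<in>{1..7::int}. 7 dvd j - t"
proof
  show "7 dvd (t - 1) mod 7 + 1 - t" by presburger
  show "(t - 1) mod 7 + 1 \<in> {1..7}" by auto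
qed

lemma row_exists:
  assumes "\<epsilon> = 1 \<or> \<epsilon> = -1"
  shows "\<exists>j\<in>{1..7}. row \<epsilon> t q j"
proof -
  \<comment> \<open>The factors 4 and 3 are the inverses of 2 and -2 modulo 7.\<close>
  have 1: "7 dvd 2 * j - u" if "7 dvd j - 4 * u" for j u :: int
  proof -
    have "2 * j - u = 2 * (j - 4 * u) + 7 * u" by simp
    then show ?thesis using that by (metis dvd_add dvd_mult dvd_triv_left)
  qed
  have 2: "7 dvd - (2 * j) - u" if "7 dvd j - 3 * u" for j u :: int
  proof -
    have "- (2 * j) - u = (-2) * (j - 3 * u) + 7 * (- u)" by simp
    then show ?thesis using that by (metis dvd_add dvd_mult dvd_triv_left)
  qed
  have *: "\<exists>j\<in>{1..7}. 7 dvd 2 * \<epsilon> * j - u" for u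
  proof (rule disjE[OF assms])
    assume "\<epsilon> = 1"
    then show ?thesis using dvd_unit_exists[of "4 * u"] 1[of _ u] by auto
  next
    assume "\<epsilon> = -1"
    then show ?thesis using dvd_unit_exists[of "3 * u"] 2[of _ u] by auto
  qed
  from *[of t] *[of "t - 1"] dvd_unit_exists[of t] dvd_unit_exists[of "t - 2 * \<epsilon>"]
  show ?thesis by (cases q) (simp_all only: row.simps)
qed

lemma row_unique:
  assumes that: "row \<epsilon> t q i" "row \<epsilon> t q j" "i \<in> {1..7}" "j \<in> {1..7}"
    and \<epsilon>: "\<epsilon> = 1 \<or> \<epsilon> = -1"
  shows "i = j"
proof -
  have d: "7 dvd i - j" if "7 dvd i - u" "7 dvd j - u" for u using dvd_diff[OF that] by simp
  have e: "7 dvd i - j" if "7 dvd 2 * \<epsilon> * i - u" "7 dvd 2 * \<epsilon> * j - u" for u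
  proof -
    have "7 dvd 2 * \<epsilon> * (i - j)" using dvd_diff[OF that] by (simp add: algebra_simps)
    moreover have "coprime 7 (2 * \<epsilon>)" using \<epsilon> by (elim disjE; simp; code_simp)
    ultimately show ?thesis by (simp add: coprime_dvd_mult_right_iff)
  qed
  have "7 dvd i - j"
    using that(1,2) d[of "t - 2 * \<epsilon>"] d[of t] e[of "t - 1"] e[of t] by (cases q) (simp_all only: row.simps)
  moreover have "1 \<le> i" "i \<le> 7" "1 \<le> j" "j \<le> 7" using that(3,4) by auto
  ultimately show "i = j" by presburger
qed

text \<open>The inner cell that fixes the pattern of a block lies in the box, hence on the lattice,
  and \<open>row_unique\<close> identifies its row with S q in every block of the side. Thus only
  the choice of patterns is free once the lattice is known.\<close>

lemma config_border:
  assumes D: "config \<epsilon> t D" and S: "\<And>q. S q \<in> {1..7} \<and> row \<epsilon> t q (S q)"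
    and \<epsilon>: "\<epsilon> = 1 \<or> \<epsilon> = -1"
  obtains \<beta> where "\<And>q k. k < len q \<Longrightarrow> \<beta> q k \<in> set (patterns (S q))"
    "D = K \<union> lattice \<epsilon> t \<union> (\<Union>q. emb q ` border (len q) (\<beta> q))"
proof -
  have "\<exists>xs. k < len q \<longrightarrow> xs \<in> set (patterns (S q)) \<and> (\<forall>j\<in>{1..7}. emb q (7 * int k + j, 0) \<in> D \<longleftrightarrow> j \<in> set xs)" for q k
  proof (cases "k < len q")
    case True
    then obtain R xs where R: "R \<in> {1..7}" "emb q (7 * int k + R, 1) \<in> D" "xs \<in> set (patterns R)"
      "\<forall>j\<in>{1..7}. emb q (7 * int k + j, 0) \<in> D \<longleftrightarrow> j \<in> set xs"
      using D unfolding config_def by blast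
    have "emb q (7 * int k + R, 1) \<in> lattice \<epsilon> t"
      using R(2) emb_I[OF True R(1)] D unfolding config_def by blast
    then have "R = S q" using lattice_row[OF True R(1)] row_unique[OF _ _ R(1) _ \<epsilon>] S by blast
    then show ?thesis using R by blast
  qed simp
  then have "\<exists>\<beta>. \<forall>q k. k < len q \<longrightarrow> \<beta> q k \<in> set (patterns (S q)) \<and>
      (\<forall>j\<in>{1..7}. emb q (7 * int k + j, 0) \<in> D \<longleftrightarrow> j \<in> set (\<beta> q k))"
    by (intro choice allI)
  then obtain \<beta> where *: "\<And>q k. k < len q \<longrightarrow> \<beta> q k \<in> set (patterns (S q)) \<and>
      (\<forall>j\<in>{1..7}. emb q (7 * int k + j, 0) \<in> D \<longleftrightarrow> j \<in> set (\<beta> q k))"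
    by blast
  then have \<beta>: "\<And>q k. k < len q \<Longrightarrow> \<beta> q k \<in> set (patterns (S q))"
    "\<And>q k j. k < len q \<Longrightarrow> j \<in> {1..7} \<Longrightarrow> emb q (7 * int k + j, 0) \<in> D \<longleftrightarrow> j \<in> set (\<beta> q k)"
    by blast+
  have sub: "set (\<beta> q k) \<subseteq> {1..7}" if "k < len q" for q k
    using \<beta>(1)[OF that] pattern_rows S by blast
  have edge: "p \<in> D \<longleftrightarrow> p \<in> emb q ` border (len q) (\<beta> q)" if p: "p \<in> edge q" for p q
  proof -
    obtain k j where kj: "k < len q" "j \<in> {1..7}" "p = emb q (7 * int k + j, 0)"
      using p by (rule edge_coord)
    show ?thesis unfolding kj(3) by (simp add: border_iff[OF sub kj(1,2)] \<beta>(2)[OF kj(1,2)])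
  qed
  have bedge: "emb q ` border (len q) (\<beta> q) \<subseteq> edge q" for q by (rule border_edge) (rule sub)
  have DI: "D \<inter> I = lattice \<epsilon> t" using D unfolding config_def by blast
  have "D = K \<union> lattice \<epsilon> t \<union> (\<Union>q. emb q ` border (len q) (\<beta> q))"
  proof (intro equalityI subsetI)
    fix p assume p: "p \<in> D"
    then have "p \<in> V" using D unfolding config_def by blast
    then show "p \<in> K \<union> lattice \<epsilon> t \<union> (\<Union>q. emb q ` border (len q) (\<beta> q))"
    proof (cases rule: V_cases)
      case 2
      then have "p \<in> lattice \<epsilon> t" using p DI by blast
      then show ?thesis by blast
    next
      case (3 q)
      then have "p \<in> emb q ` border (len q) (\<beta> q)" using edge p by blast
      then show ?thesis by blast
    qed blast
  next
    fix p assume "p \<in> K \<union> lattice \<epsilon> t \<union> (\<Union>q. emb q ` border (len q) (\<beta> q))"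
    then consider "p \<in> K" | "p \<in> lattice \<epsilon> t" | q where "p \<in> emb q ` border (len q) (\<beta> q)" by blast
    then show "p \<in> D"
    proof cases
      case 1 then show ?thesis using D unfolding config_def by blast
    next
      case 2 then show ?thesis using DI by blast
    next
      case (3 q) then show ?thesis using bedge[of q] edge[of p q] by blast
    qed
  qed
  then show thesis using that \<beta>(1) by blast
qed

lemma configI:
  assumes S: "\<And>q. S q \<in> {1..7} \<and> row \<epsilon> t q (S q)"
    and \<beta>: "\<And>q k. k < len q \<Longrightarrow> \<beta> q k \<in> set (patterns (S q))"
  shows "config \<epsilon> t (K \<union> lattice \<epsilon> t \<union> (\<Union>q. emb q ` border (len q) (\<beta> q)))" (is "config \<epsilon> t ?D")
proof -
  have sub: "set (\<beta> q k) \<subseteq> {1..7}" if "k < len q" for q k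
    using \<beta>[OF that] pattern_rows S by blast
  have bedge: "emb q ` border (len q) (\<beta> q) \<subseteq> edge q" for q by (rule border_edge) (rule sub)
  have "emb q ` border (len q) (\<beta> q) \<subseteq> V" for q
    using bedge[of q] subset_V(3)[of q] by (rule subset_trans)
  moreover have "lattice \<epsilon> t \<subseteq> V" using lattice_I subset_V(2) by (rule subset_trans)
  ultimately have "?D \<subseteq> V" using subset_V(1) by (simp add: UN_subset_iff)
  moreover have "?D \<inter> I = lattice \<epsilon> t"
  proof -
    have "emb q ` border (len q) (\<beta> q) \<inter> I = {}" for q
      using bedge[of q] edge_KI[of _ q] by auto
    then have "(\<Union>q. emb q ` border (len q) (\<beta> q)) \<inter> I = {}" by auto
    then show ?thesis using KI_disjoint lattice_I[of \<epsilon> t] by (simp only: Int_Un_distrib2) auto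
  qed
  moreover have "\<exists>R\<in>{1..7}. emb q (7 * int k + R, 1) \<in> ?D \<and>
        (\<exists>xs\<in>set (patterns R). \<forall>j\<in>{1..7}. emb q (7 * int k + j, 0) \<in> ?D \<longleftrightarrow> j \<in> set xs)" if k: "k < len q" for q k
  proof (intro bexI conjI ballI)
    show "S q \<in> {1..7}" using S by blast
    show "emb q (7 * int k + S q, 1) \<in> ?D" using lattice_row[OF k] S by blast
    show "\<beta> q k \<in> set (patterns (S q))" using \<beta> k .
    fix j :: int assume j: "j \<in> {1..7}"
    have e: "emb q (7 * int k + j, 0) \<in> edge q" using emb_edge k j .
    define p where "p = emb q (7 * int k + j, 0)"
    define B where "B q = emb q ` border (len q) (\<beta> q)" for q
    have "p \<in> edge q" using e unfolding p_def .
    then have "p \<notin> K \<union> lattice \<epsilon> t"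
      using edge_KI[of p q] subsetD[OF lattice_I, of p \<epsilon> t] by (metis Un_iff)
    moreover have "q' = q" if "p \<in> B q'" for q'
    proof (rule ccontr)
      assume "q' \<noteq> q"
      moreover have "p \<in> edge q'" using bedge[of q'] that unfolding B_def by (rule subsetD)
      ultimately show False using edge_disjoint \<open>p \<in> edge q\<close> by metis
    qed
    moreover have "p \<in> B q \<longleftrightarrow> j \<in> set (\<beta> q k)"
      unfolding p_def B_def by (rule border_iff[OF _ k j]) (rule sub)
    ultimately have "p \<in> K \<union> lattice \<epsilon> t \<union> (\<Union>q. B q) \<longleftrightarrow> j \<in> set (\<beta> q k)"
      by blast
    then show "emb q (7 * int k + j, 0) \<in> ?D \<longleftrightarrow> j \<in> set (\<beta> q k)"
      unfolding p_def B_def .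
  qed
  moreover have "K \<subseteq> ?D" by blast
  ultimately show ?thesis unfolding config_def by (intro conjI allI impI)
qed


section \<open>The switch on the cells away from crossed sides\<close>

definition bulk :: "int \<Rightarrow> int \<Rightarrow> int \<Rightarrow> int \<Rightarrow> (int \<times> int) set" where
  "bulk t s \<epsilon> u = {p. 7 dvd fst p + 2 * \<epsilon> * snd p - u \<and>
     bulk_range (int a) (cross_x t s) (fst p) \<and> bulk_range (int b) (cross_y t s) (snd p)}"

text \<open>Reflecting y to H - y turns the way back from x - 2y = s to x + 2y = t into a switch of
  the original kind, with parameters s + 2H and t - 2H. Their sum is s + t, and their difference is
  -(s - t) - 4 modulo 7, under which {4,5,6} is stable.\<close>

lemma cross_reflect:
  "cross_x (s + 2 * H) (t - 2 * H) = cross_x t s" "cross_y (s + 2 * H) (t - 2 * H) = cross_y t s"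
proof -
  show "cross_x (s + 2 * H) (t - 2 * H) = cross_x t s" by (simp add: cross_x_def add.commute)
  obtain k m where km: "s - t = 7 * k + m" "(s - t) mod 7 = m" by (metis mult_div_mod_eq)
  have "(t - 2 * H) - (s + 2 * H) = 0 + (- m - 4) + 7 * (- k - 4 * int b)"
    using km(1) unfolding H_def by (simp add: algebra_simps)
  then have "((t - 2 * H) - (s + 2 * H)) mod 7 = (- m - 4) mod 7"
    by (simp only: mod7_shift) simp
  then show "cross_y (s + 2 * H) (t - 2 * H) = cross_y t s"
    unfolding cross_y_def using km(2)[symmetric]
    by (cases rule: mod7_cases[of "s - t"]) simp_all
qed

lemma bulk_king_move: "king_move (bulk t s 1 t) (bulk t s (-1) s)"
proof -
  define f where "f p = (fst p + step_x (s - fst p + 2 * snd p), snd p + step_y (s - fst p + 2 * snd p))"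
    for p :: "int \<times> int"
  define g where "g p = (fst p + step_x (t - fst p - 2 * snd p), snd p - step_y (t - fst p - 2 * snd p))"
    for p :: "int \<times> int"
  have f: "f p \<in> bulk t s (-1) s" "g (f p) = p" if "p \<in> bulk t s 1 t" for p
  proof -
    have p: "7 dvd fst p + 2 * snd p - t" "bulk_range (int a) (cross_x t s) (fst p)"
      "bulk_range (int b) (cross_y t s) (snd p)"
      using that by (simp_all add: bulk_def)
    show "f p \<in> bulk t s (-1) s"
      using step_lattice(1)[OF p(1), of s] step_x_range[OF p(1,2)] step_y_range[OF p(1,3)]
      by (simp add: bulk_def f_def)
    define r where "r = s - fst p + 2 * snd p"
    have "f p = (fst p + step_x r, snd p + step_y r)" by (simp add: f_def r_def)
    then show "g (f p) = p"
      using step_lattice(2,3)[OF p(1), of s, folded r_def]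
      by (simp only: g_def fst_conv snd_conv prod_eq_iff)
  qed
  have g: "g p \<in> bulk t s 1 t" "f (g p) = p" if "p \<in> bulk t s (-1) s" for p
  proof -
    \<comment> \<open>In reflected coordinates the range lemmas for the forward switch apply to g,
      with s + 2H in the role of t and t - 2H in the role of s.\<close>
    let ?y = "H - snd p" and ?s = "s + 2 * H" and ?t = "t - 2 * H"
    have range: "bulk_range (int b) c (H - y) = bulk_range (int b) c y" for c y
      unfolding bulk_range_def H_def by auto
    have p1: "7 dvd fst p + 2 * ?y - ?s" using that by (simp add: bulk_def algebra_simps)
    have "bulk_range (int a) (cross_x ?s ?t) (fst p)" "bulk_range (int b) (cross_y ?s ?t) ?y"
      using that unfolding cross_reflect range by (simp_all add: bulk_def)
    note p = p1 this
    define r where "r = ?t - fst p + 2 * ?y"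
    have r: "t - fst p - 2 * snd p = r" unfolding r_def by simp
    have y: "snd p - step_y r = H - (?y + step_y r)" by simp
    note step = step_lattice[OF p(1), of ?t, folded r_def]
    have "7 dvd fst p + step_x r + 2 * (snd p - step_y r) - t"
      using step(1) by (simp add: algebra_simps)
    moreover have "bulk_range (int a) (cross_x t s) (fst p + step_x r)"
      using step_x_range[OF p(1,2)] unfolding cross_reflect r_def .
    moreover have "bulk_range (int b) (cross_y t s) (snd p - step_y r)"
      using step_y_range[OF p(1,3)] unfolding cross_reflect r_def[symmetric] y range .
    ultimately show "g p \<in> bulk t s 1 t" by (simp add: bulk_def g_def r)
    have q: "?s - (fst p + step_x r) - 2 * (?y + step_y r) =
        s - (fst p + step_x r) + 2 * (snd p - step_y r)" by (simp add: algebra_simps)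
    show "f (g p) = p"
      using step(2,3) unfolding q by (simp add: f_def g_def r prod_eq_iff)
  qed
  show ?thesis unfolding king_move_def
  proof (intro exI conjI ballI)
    show "bij_betw f (bulk t s 1 t) (bulk t s (-1) s)"
      by (rule bij_betw_byWitness[of _ g]) (use f g in auto)
    show "near p (f p)" for p
      by (simp add: near_def f_def step_x_def step_y_def)
  qed
qed


text \<open>The cells A are the sources and B the targets that are served by the border guards of side q.
  A source or target with second coordinate 0 is a corner of the grid.\<close>

definition passage :: "side \<Rightarrow> (int \<times> int) set \<Rightarrow> (int \<times> int) set \<Rightarrow> int \<Rightarrow> int \<Rightarrow> bool" where
  "passage q A B S T \<longleftrightarrow> A = {} \<and> B = {} \<or>
     (\<exists>S' T' c d. exchange S T S' T' \<and>
       (\<forall>k<len q. c k = 1 \<or> c k = 0 \<and> 7 * int k + S' \<notin> {1..7 * int (len q)}) \<and>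
       (\<forall>k<len q. d k = 1 \<or> d k = 0 \<and> 7 * int k + T' \<notin> {1..7 * int (len q)}) \<and>
       A = emb q ` (\<lambda>k. (7 * int k + S', c k)) ` {..<len q} \<and>
       B = emb q ` (\<lambda>k. (7 * int k + T', d k)) ` {..<len q})"

lemma passage_king_move:
  assumes "passage q A B S T" and S: "S \<in> {1..7}" and T: "T \<in> {1..7}"
    and \<beta>: "\<And>k. k < len q \<Longrightarrow> \<beta> k \<in> set (patterns S)"
  shows "\<exists>\<beta>'. (\<forall>k<len q. \<beta>' k \<in> set (patterns T)) \<and>
    king_move (emb q ` border (len q) \<beta> \<union> A) (emb q ` border (len q) \<beta>' \<union> B)"
  using assms(1) unfolding passage_def
proof (elim disjE exE conjE)
  assume "A = {}" "B = {}"
  have "shift S T" using shift_rows S T by blast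
  obtain \<beta>' where \<beta>': "\<forall>k<len q. \<beta>' k \<in> set (patterns T)" "king_move (border (len q) \<beta>) (border (len q) \<beta>')"
    using side_shift[OF S T \<open>shift S T\<close>, of "len q" \<beta>] \<beta> by blast
  show ?thesis
    using king_move_image[OF \<beta>'(2) near_emb inj_emb, of q] \<beta>'(1) unfolding \<open>A = {}\<close> \<open>B = {}\<close> Un_empty_right by blast
next
  fix S' T' c d
  assume *: "exchange S T S' T'"
    "\<forall>k<len q. c k = 1 \<or> c k = 0 \<and> 7 * int k + S' \<notin> {1..7 * int (len q)}"
    "\<forall>k<len q. d k = 1 \<or> d k = 0 \<and> 7 * int k + T' \<notin> {1..7 * int (len q)}"
    and AB: "A = emb q ` (\<lambda>k. (7 * int k + S', c k)) ` {..<len q}"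
      "B = emb q ` (\<lambda>k. (7 * int k + T', d k)) ` {..<len q}"
  obtain \<beta>' where \<beta>': "\<forall>k<len q. \<beta>' k \<in> set (patterns T)"
    "king_move (border (len q) \<beta> \<union> (\<lambda>k. (7 * int k + S', c k)) ` {..<len q})
       (border (len q) \<beta>' \<union> (\<lambda>k. (7 * int k + T', d k)) ` {..<len q})"
    using side_exchange[OF S T *(1), of "len q" \<beta> c d] \<beta> *(2,3) by blast
  show ?thesis
    using king_move_image[OF \<beta>'(2) near_emb inj_emb, of q] \<beta>'(1) unfolding AB image_Un by blast
qed

lemma label_split:
  assumes "\<And>g q. g \<in> B q \<Longrightarrow> L g = Some q" "\<And>g. g \<in> M \<Longrightarrow> L g = l g"
  shows "{g \<in> M \<union> (\<Union>q. B q). L g = None} = {g \<in> M. l g = None}"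
    "{g \<in> M \<union> (\<Union>q. B q). L g = Some q} = B q \<union> {g \<in> M. l g = Some q}"
proof -
  have *: "L g = None \<longleftrightarrow> l g = None" "L g = Some q \<longleftrightarrow> l g = Some q" if "g \<in> M" for g
    using assms(2)[OF that] by simp_all
  show "{g \<in> M \<union> (\<Union>q. B q). L g = None} = {g \<in> M. l g = None}"
    by (auto simp: * dest!: assms(1))
  show "{g \<in> M \<union> (\<Union>q. B q). L g = Some q} = B q \<union> {g \<in> M. l g = Some q}"
    by (auto simp: * assms(1) dest: assms(1))
qed

text \<open>Guards are grouped by label: each side collects its border guards and the inner cells or
  corners that they serve, and one group holds the rest. A passage moves the group of a side, and
  the moves of disjoint groups combine.\<close>

lemma assemble:
  assumes D: "config 1 t D"
    and S: "\<And>q. S q \<in> {1..7} \<and> row 1 t q (S q)"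
    and T: "\<And>q. T q \<in> {1..7} \<and> row (-1) s q (T q)"
    and rest: "king_move {g \<in> lattice 1 t \<union> K. lab g = None} {h \<in> lattice (-1) s \<union> K. lab' h = None}"
    and side: "\<And>q. passage q {g \<in> lattice 1 t \<union> K. lab g = Some q}
      {h \<in> lattice (-1) s \<union> K. lab' h = Some q} (S q) (T q)"
  shows "\<exists>D'. config (-1) s D' \<and> king_move D D'"
proof -
  obtain \<beta> where \<beta>: "\<And>q k. k < len q \<Longrightarrow> \<beta> q k \<in> set (patterns (S q))"
    "D = K \<union> lattice 1 t \<union> (\<Union>q. emb q ` border (len q) (\<beta> q))"
    by (rule config_border[OF D S disjI1[OF refl]]) (rule that; assumption | simp)
  have "\<exists>\<beta>'. \<forall>q. (\<forall>k<len q. \<beta>' q k \<in> set (patterns (T q))) \<and>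
      king_move (emb q ` border (len q) (\<beta> q) \<union> {g \<in> lattice 1 t \<union> K. lab g = Some q})
         (emb q ` border (len q) (\<beta>' q) \<union> {h \<in> lattice (-1) s \<union> K. lab' h = Some q})"
    by (rule choice, rule allI, rule passage_king_move[OF side]) (use S T \<beta>(1) in auto)
  then obtain \<beta>' where \<beta>': "\<And>q k. k < len q \<Longrightarrow> \<beta>' q k \<in> set (patterns (T q))"
      "\<And>q. king_move (emb q ` border (len q) (\<beta> q) \<union> {g \<in> lattice 1 t \<union> K. lab g = Some q})
         (emb q ` border (len q) (\<beta>' q) \<union> {h \<in> lattice (-1) s \<union> K. lab' h = Some q})"
    by blast
  define D' where "D' = K \<union> lattice (-1) s \<union> (\<Union>q. emb q ` border (len q) (\<beta>' q))"
  \<comment> \<open>The given labels concern corners and inner cells; a border cell is labelled by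
    the unique side that contains it.\<close>
  define full where "full l p = (if p \<in> K \<union> I then l p else Some (THE q. p \<in> edge q))"
    for l :: "int \<times> int \<Rightarrow> side option" and p
  have full: "full l p = Some q" if "p \<in> edge q" for l p q
  proof -
    have "(THE q. p \<in> edge q) = q" by (intro the_equality that) (metis edge_disjoint that)
    then show ?thesis using edge_KI[OF that] unfolding full_def by simp
  qed
  have split: "{g \<in> K \<union> lattice \<epsilon> u \<union> (\<Union>q. emb q ` border (len q) (\<gamma> q)). full l g = None} =
        {g \<in> lattice \<epsilon> u \<union> K. l g = None}"
      "{g \<in> K \<union> lattice \<epsilon> u \<union> (\<Union>q. emb q ` border (len q) (\<gamma> q)). full l g = Some q'} =
        emb q' ` border (len q') (\<gamma> q') \<union> {g \<in> lattice \<epsilon> u \<union> K. l g = Some q'}"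
    if \<gamma>: "\<And>q k. k < len q \<Longrightarrow> set (\<gamma> q k) \<subseteq> {1..7}" for \<epsilon> u l \<gamma> q'
  proof -
    have e: "emb q ` border (len q) (\<gamma> q) \<subseteq> edge q" for q by (rule border_edge) (rule \<gamma>)
    have 1: "full l g = Some q" if "g \<in> emb q ` border (len q) (\<gamma> q)" for g q
      by (rule full) (rule subsetD[OF e that])
    have 2: "full l g = l g" if "g \<in> lattice \<epsilon> u \<union> K" for g
      using that lattice_I[of \<epsilon> u] unfolding full_def by auto
    note split = label_split[of "\<lambda>q. emb q ` border (len q) (\<gamma> q)" "full l" "lattice \<epsilon> u \<union> K" l, OF 1 2]
    show "{g \<in> K \<union> lattice \<epsilon> u \<union> (\<Union>q. emb q ` border (len q) (\<gamma> q)). full l g = None} =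
        {g \<in> lattice \<epsilon> u \<union> K. l g = None}"
      unfolding Un_commute[of K] by (rule split(1))
    show "{g \<in> K \<union> lattice \<epsilon> u \<union> (\<Union>q. emb q ` border (len q) (\<gamma> q)). full l g = Some q'} =
        emb q' ` border (len q') (\<gamma> q') \<union> {g \<in> lattice \<epsilon> u \<union> K. l g = Some q'}"
      unfolding Un_commute[of K] by (rule split(2))
  qed
  have subS: "set (\<beta> q k) \<subseteq> {1..7}" and subT: "set (\<beta>' q k) \<subseteq> {1..7}" if "k < len q" for q k
    using \<beta>(1)[OF that] \<beta>'(1)[OF that] pattern_rows S[of q] T[of q] by blast+
  have DS: "{g \<in> D. full l g = None} = {g \<in> lattice 1 t \<union> K. l g = None}"
    "{g \<in> D. full l g = Some q} = emb q ` border (len q) (\<beta> q) \<union> {g \<in> lattice 1 t \<union> K. l g = Some q}" for l q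
    unfolding \<beta>(2) by (rule split, rule subS, assumption)+
  have DT: "{g \<in> D'. full l g = None} = {g \<in> lattice (-1) s \<union> K. l g = None}"
    "{g \<in> D'. full l g = Some q} = emb q ` border (len q) (\<beta>' q) \<union> {g \<in> lattice (-1) s \<union> K. l g = Some q}" for l q
    unfolding D'_def by (rule split, rule subT, assumption)+
  have "king_move D D'"
  proof (rule king_move_label[of _ "full lab" _ "full lab'"])
    fix i
    show "king_move {g \<in> D. full lab g = i} {h \<in> D'. full lab' h = i}"
    proof (cases i)
      case None
      show ?thesis unfolding None DS(1) DT(1) by (rule rest)
    next
      case (Some q)
      show ?thesis unfolding Some DS(2) DT(2) by (rule \<beta>'(2))
    qed
  qed
  moreover have "config (-1) s D'" unfolding D'_def by (rule configI[OF T \<beta>'(1)])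
  ultimately show ?thesis by blast
qed


section \<open>Assigning the guards near the border to the sides\<close>

primrec inner :: "side \<Rightarrow> int \<times> int \<Rightarrow> bool" where
  "inner Lft p \<longleftrightarrow> fst p = 1"
| "inner Bot p \<longleftrightarrow> snd p = 1"
| "inner Rgt p \<longleftrightarrow> fst p = 7 * int a"
| "inner Top p \<longleftrightarrow> snd p = 7 * int b"

lemma inner_lattice:
  assumes R: "row \<epsilon> u q R" "R \<in> {1..7}" and \<epsilon>: "\<epsilon> = 1 \<or> \<epsilon> = -1"
  shows "{p \<in> lattice \<epsilon> u. inner q p} = emb q ` (\<lambda>k. (7 * int k + R, 1)) ` {..<len q}"
proof (intro equalityI subsetI)
  fix p assume p: "p \<in> {p \<in> lattice \<epsilon> u. inner q p}"
  then have "p \<in> I" "inner q p" using lattice_I by blast+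
  then have "\<exists>i\<in>{1..7 * int (len q)}. p = emb q (i, 1)"
  proof (cases q)
    case Lft
    then show ?thesis using \<open>p \<in> I\<close> \<open>inner q p\<close>
      by (intro bexI[of _ "snd p"]) (auto simp: I_def prod_eq_iff)
  next
    case Bot
    then show ?thesis using \<open>p \<in> I\<close> \<open>inner q p\<close>
      by (intro bexI[of _ "fst p"]) (auto simp: I_def prod_eq_iff)
  next
    case Rgt
    then show ?thesis using \<open>p \<in> I\<close> \<open>inner q p\<close>
      by (intro bexI[of _ "snd p"]) (auto simp: I_def W_def prod_eq_iff)
  next
    case Top
    then show ?thesis using \<open>p \<in> I\<close> \<open>inner q p\<close>
      by (intro bexI[of _ "fst p"]) (auto simp: I_def H_def prod_eq_iff)
  qed
  then obtain i where i: "i \<in> {1..7 * int (len q)}" "p = emb q (i, 1)" by blast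
  obtain k j where kj: "k < len q" "j \<in> {1..7}" "i = 7 * int k + j" using coord[OF i(1)] .
  have "row \<epsilon> u q j" using p lattice_row[OF kj(1,2)] unfolding i(2) kj(3) by blast
  then have "j = R" by (rule row_unique[OF _ R(1) kj(2) R(2) \<epsilon>])
  then show "p \<in> emb q ` (\<lambda>k. (7 * int k + R, 1)) ` {..<len q}"
    unfolding i(2) kj(3) using kj(1) by (intro imageI) simp
next
  fix p assume "p \<in> emb q ` (\<lambda>k. (7 * int k + R, 1)) ` {..<len q}"
  then obtain k where k: "k < len q" "p = emb q (7 * int k + R, 1)" by auto
  have "p \<in> lattice \<epsilon> u" unfolding k(2) using lattice_row[OF k(1) R(2)] R(1) by blast
  moreover have "inner q p" unfolding k(2) by (cases q) (simp_all add: W_def H_def)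
  ultimately show "p \<in> {p \<in> lattice \<epsilon> u. inner q p}" by blast
qed

text \<open>The order of the tests decides which side serves an inner corner of the box in the
  diagonal cases below.\<close>

definition zone :: "(int \<times> int \<Rightarrow> side option) \<Rightarrow> bool \<Rightarrow> bool \<Rightarrow> int \<times> int \<Rightarrow> side option" where
  "zone \<kappa> cx cy p =
    (if p \<in> K then \<kappa> p else if cx \<and> inner Lft p then Some Lft else if cy \<and> inner Bot p then Some Bot
     else if cy \<and> inner Top p then Some Top else if cx \<and> inner Rgt p then Some Rgt else None)"

lemma zone_K: "p \<in> K \<Longrightarrow> zone \<kappa> cx cy p = \<kappa> p"
  by (simp add: zone_def)

lemma zone_lattice: "p \<in> lattice \<epsilon> u \<Longrightarrow> zone \<kappa> cx cy p =
    (if cx \<and> inner Lft p then Some Lft else if cy \<and> inner Bot p then Some Bot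
     else if cy \<and> inner Top p then Some Top else if cx \<and> inner Rgt p then Some Rgt else None)"
proof -
  assume "p \<in> lattice \<epsilon> u"
  then have "p \<in> I" by (rule subsetD[OF lattice_I])
  then have "p \<notin> K" using KI_disjoint by blast
  then show ?thesis by (simp only: zone_def if_False)
qed

lemma zone_Some:
  "{p \<in> lattice \<epsilon> u \<union> K. zone \<kappa> cx cy p = Some q} =
    {p \<in> K. \<kappa> p = Some q} \<union> {p \<in> lattice \<epsilon> u. zone \<kappa> cx cy p = Some q}"
  by (intro set_eqI) (auto simp: zone_K)

lemma zone_None:
  "{p \<in> lattice \<epsilon> u \<union> K. zone \<kappa> (cross_x t s) (cross_y t s) p = None} = bulk t s \<epsilon> u \<union> {p \<in> K. \<kappa> p = None}"
proof -
  have "{p \<in> lattice \<epsilon> u. zone \<kappa> (cross_x t s) (cross_y t s) p = None} = bulk t s \<epsilon> u"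
  proof (intro set_eqI)
    fix p
    have "p \<in> bulk t s \<epsilon> u \<longleftrightarrow> p \<in> lattice \<epsilon> u \<and>
        \<not> (cross_x t s \<and> (inner Lft p \<or> inner Rgt p)) \<and> \<not> (cross_y t s \<and> (inner Bot p \<or> inner Top p))"
      by (cases p) (simp add: bulk_def bulk_range_def lattice_def I_def, blast)
    moreover have "zone \<kappa> (cross_x t s) (cross_y t s) p = None \<longleftrightarrow>
        \<not> (cross_x t s \<and> (inner Lft p \<or> inner Rgt p)) \<and> \<not> (cross_y t s \<and> (inner Bot p \<or> inner Top p))"
      if "p \<in> lattice \<epsilon> u"
      unfolding zone_lattice[OF that] by (simp del: inner.simps)
    ultimately show "p \<in> {p \<in> lattice \<epsilon> u. zone \<kappa> (cross_x t s) (cross_y t s) p = None} \<longleftrightarrow> p \<in> bulk t s \<epsilon> u"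
      by blast
  qed
  moreover have "{p \<in> K. zone \<kappa> (cross_x t s) (cross_y t s) p = None} = {p \<in> K. \<kappa> p = None}"
    by (simp add: zone_K cong: conj_cong)
  ultimately show ?thesis by blast
qed

lemma bulk_K: "bulk t s \<epsilon> u \<inter> K = {}"
proof -
  have "bulk t s \<epsilon> u \<subseteq> I" by (clarsimp simp: bulk_def bulk_range_def I_def)
  then show ?thesis using KI_disjoint by blast
qed

lemma zone_rest:
  assumes "{p \<in> K. \<kappa> p = None} = {p \<in> K. \<kappa>' p = None}"
  shows "king_move {p \<in> lattice 1 t \<union> K. zone \<kappa> (cross_x t s) (cross_y t s) p = None}
    {p \<in> lattice (-1) s \<union> K. zone \<kappa>' (cross_x t s) (cross_y t s) p = None}"
proof -
  have dis: "bulk t s \<epsilon> u \<inter> {p \<in> K. P p} = {}" for \<epsilon> u P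
    using bulk_K[of t s \<epsilon> u] by blast
  show ?thesis
    unfolding zone_None assms by (rule king_move_Un[OF bulk_king_move king_move_refl dis dis])
qed

lemma passage_full:
  assumes "row 1 t q S" "S \<in> {1..7}" "row (-1) s q T" "T \<in> {1..7}"
  shows "passage q {p \<in> lattice 1 t. inner q p} {p \<in> lattice (-1) s. inner q p} S T"
proof -
  have "exchange S T S T" using exchange_rows assms by blast
  then show ?thesis
    unfolding inner_lattice[OF assms(1,2) disjI1[OF refl]] inner_lattice[OF assms(3,4) disjI2[OF refl]] passage_def
    by (intro disjI2 exI[of _ S] exI[of _ T] exI[of _ "\<lambda>_. 1"]) simp
qed

lemma mod7_linear: "((x::int) + c * y) mod 7 = (x mod 7 + c * (y mod 7)) mod 7"
  by (intro mod_add_cong) (simp_all add: mod_mult_right_eq)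

lemma lattice_mod:
  assumes "p \<in> lattice \<epsilon> u"
  shows "u mod 7 = (fst p mod 7 + 2 * \<epsilon> * (snd p mod 7)) mod 7"
proof -
  have "7 dvd fst p + 2 * \<epsilon> * snd p - u" using assms by (simp add: lattice_def)
  then have "u mod 7 = (fst p + 2 * \<epsilon> * snd p) mod 7" by (metis mod_eq_dvd_iff)
  also have "\<dots> = (fst p mod 7 + 2 * \<epsilon> * (snd p mod 7)) mod 7" by (rule mod7_linear)
  finally show ?thesis .
qed

lemma lattice_corner:
  assumes "p \<in> lattice \<epsilon> u" "inner Lft p \<or> inner Rgt p" "inner Bot p \<or> inner Top p"
  shows "u mod 7 \<in> {0, 1, (2 * \<epsilon>) mod 7, (1 + 2 * \<epsilon>) mod 7}"
proof -
  have u: "u mod 7 = (fst p mod 7 + 2 * \<epsilon> * (snd p mod 7)) mod 7"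
    using assms(1) by (rule lattice_mod)
  have x: "fst p mod 7 = 0 \<or> fst p mod 7 = 1" and y: "snd p mod 7 = 0 \<or> snd p mod 7 = 1"
    using assms(2,3) by (elim disjE; simp)+
  show ?thesis using x y unfolding u by (elim disjE; simp)
qed

text \<open>The pairs for which a guard moves diagonally between a corner of the grid and the
  adjacent corner of the box.\<close>

definition diagonal :: "int \<Rightarrow> int \<Rightarrow> bool" where
  "diagonal t s \<longleftrightarrow> (t mod 7, s mod 7) \<in> {(0,6), (3,0), (1,5), (2,1)}"

text \<open>All four sides are crossed for six pairs (t, s) modulo 7: the four in
  \<open>diagonal\<close>, and (4,2) and (6,4). In the last two cases no corner of the box lies on
  either lattice, because such corners require t in {0,1,2,3} or s in {0,1,5,6}. Hence no lattice
  cell belongs to two crossed sides, and every crossed side handles exactly the lattice cells next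
  to it.\<close>

lemma step_generic:
  assumes D: "config 1 t D" and nd: "\<not> diagonal t s"
  shows "\<exists>D'. config (-1) s D' \<and> king_move D D'"
proof -
  obtain S where S: "\<And>q. S q \<in> {1..7} \<and> row 1 t q (S q)" using row_exists[of 1 t] by metis
  obtain T where T: "\<And>q. T q \<in> {1..7} \<and> row (-1) s q (T q)" using row_exists[of "-1" s] by metis
  let ?z = "zone (\<lambda>_. None) (cross_x t s) (cross_y t s)"
  have "t mod 7 \<in> {4,6} \<and> s mod 7 \<in> {2,4}" if "cross_x t s" "cross_y t s"
  proof -
    have "(s mod 7 + t mod 7) mod 7 \<in> {3, 6}" "(s mod 7 - t mod 7) mod 7 \<in> {4, 5, 6}"
      using that unfolding cross_x_def cross_y_def by (simp_all add: mod_simps)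
    then show ?thesis using nd unfolding diagonal_def
      by (cases rule: mod7_cases[of s]; cases rule: mod7_cases[of t]; simp)
  qed
  then have no: "\<not> (cross_x t s \<and> (inner Lft p \<or> inner Rgt p) \<and> cross_y t s \<and> (inner Bot p \<or> inner Top p))"
    if "p \<in> lattice 1 t \<or> p \<in> lattice (-1) s" for p
    using that lattice_corner[of p 1 t] lattice_corner[of p "-1" s] by auto
  define crossed where "crossed q = (case q of Lft \<Rightarrow> cross_x t s | Rgt \<Rightarrow> cross_x t s
      | Bot \<Rightarrow> cross_y t s | Top \<Rightarrow> cross_y t s)" for q
  have seven: "7 * int a \<noteq> 1" "7 * int b \<noteq> 1" by presburger+
  have ne: "inner Lft p \<Longrightarrow> \<not> inner Rgt p" "inner Bot p \<Longrightarrow> \<not> inner Top p" for p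
    using seven by auto
  have z: "{p \<in> lattice \<epsilon> u \<union> K. ?z p = Some q} = (if crossed q then {p \<in> lattice \<epsilon> u. inner q p} else {})"
    if "(\<epsilon>, u) = (1, t) \<or> (\<epsilon>, u) = (-1, s)" for \<epsilon> u q
  proof -
    have "?z p = Some q \<longleftrightarrow> crossed q \<and> inner q p" if p: "p \<in> lattice \<epsilon> u" for p
    proof -
      have "p \<in> lattice 1 t \<or> p \<in> lattice (-1) s" using p \<open>_ \<or> _\<close> by auto
      then show ?thesis using no[of p] ne[of p] unfolding zone_lattice[OF p] crossed_def
        by (cases q) (auto simp del: inner.simps)
    qed
    then show ?thesis unfolding zone_Some by auto
  qed
  show ?thesis
  proof (rule assemble[OF D S T, where lab = ?z and lab' = ?z])
    show "king_move {g \<in> lattice 1 t \<union> K. ?z g = None} {h \<in> lattice (-1) s \<union> K. ?z h = None}"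
      by (rule zone_rest) (rule refl)
    show "passage q {g \<in> lattice 1 t \<union> K. ?z g = Some q} {h \<in> lattice (-1) s \<union> K. ?z h = Some q} (S q) (T q)"
      for q
    proof (cases "crossed q")
      case True
      then show ?thesis unfolding z[OF disjI1[OF refl]] z[OF disjI2[OF refl]]
        using passage_full[of t q "S q" s "T q"] S T by simp
    next
      case False
      then show ?thesis unfolding z[OF disjI1[OF refl]] z[OF disjI2[OF refl]] by (simp add: passage_def)
    qed
  qed
qed

end

section \<open>Passing guards along a side and around a corner of the grid\<close>

lemma shift_down:
  assumes "0 < N"
  shows "insert (0, 0) ((\<lambda>k. (7 * int k + 7, 1::int)) ` {..<N} - {(7 * int N, 1)}) =
    (\<lambda>k. (7 * int k + 0, if k = 0 then 0 else 1)) ` {..<N}"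
proof -
  obtain M where M: "N = Suc M" using assms by (cases N) auto
  have "(\<lambda>k. (7 * int k + 7, 1::int)) ` {..<N} - {(7 * int N, 1)} = (\<lambda>k. (7 * int k + 7, 1)) ` {..<M}"
    unfolding M lessThan_Suc by auto
  also have "insert (0, 0) \<dots> = (\<lambda>k. (7 * int k + 0, if k = 0 then 0 else 1)) ` {..<N}"
    unfolding M lessThan_Suc_eq_insert_0 by (simp add: image_image add.commute)
  finally show ?thesis .
qed

lemma shift_up:
  assumes "0 < N"
  shows "insert (7 * int N + 1, 0) ((\<lambda>k. (7 * int k + 1, 1::int)) ` {..<N} - {(1, 1)}) =
    (\<lambda>k. (7 * int k + 8, if k = N - 1 then 0 else 1)) ` {..<N}"
proof -
  obtain M where M: "N = Suc M" using assms by (cases N) auto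
  have "(\<lambda>k. (7 * int k + 1, 1::int)) ` {..<N} - {(1, 1)} = (\<lambda>k. (7 * int k + 8, 1)) ` {..<M}"
    unfolding M lessThan_Suc_eq_insert_0 by (auto simp: image_image)
  moreover have "(\<lambda>k. (7 * int k + 8, if k = N - 1 then 0 else 1)) ` {..<M} = (\<lambda>k. (7 * int k + 8, 1::int)) ` {..<M}"
    unfolding M by (intro image_cong) auto
  ultimately show ?thesis unfolding M lessThan_Suc by (simp add: algebra_simps)
qed

context grid begin

lemma len_pos: "0 < len q"
  using a_pos b_pos by (cases q) auto

text \<open>Row 7 of a block is row 0 of the next one. Dropping the last such cell and adding the
  corner at position 0 therefore leaves one cell per block, now in row 0. In
  \<open>inner_shift_up\<close> rows 1 and 8 and the corner at the other end play these
  parts.\<close>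

lemma inner_shift_down:
  assumes "row \<epsilon> u q 7" "\<epsilon> = 1 \<or> \<epsilon> = -1"
  shows "insert (emb q (0, 0)) ({p \<in> lattice \<epsilon> u. inner q p} - {emb q (7 * int (len q), 1)}) =
    emb q ` (\<lambda>k. (7 * int k + 0, if k = 0 then 0 else 1)) ` {..<len q}"
proof -
  have "{p \<in> lattice \<epsilon> u. inner q p} = emb q ` (\<lambda>k. (7 * int k + 7, 1)) ` {..<len q}"
    using assms by (intro inner_lattice) simp_all
  then show ?thesis
    unfolding shift_down[OF len_pos, symmetric] image_insert image_set_diff[OF inj_emb] by simp
qed

lemma inner_shift_up:
  assumes "row \<epsilon> u q 1" "\<epsilon> = 1 \<or> \<epsilon> = -1"
  shows "insert (emb q (7 * int (len q) + 1, 0)) ({p \<in> lattice \<epsilon> u. inner q p} - {emb q (1, 1)}) =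
    emb q ` (\<lambda>k. (7 * int k + 8, if k = len q - 1 then 0 else 1)) ` {..<len q}"
proof -
  have "{p \<in> lattice \<epsilon> u. inner q p} = emb q ` (\<lambda>k. (7 * int k + 1, 1)) ` {..<len q}"
    using assms by (intro inner_lattice) simp_all
  then show ?thesis
    unfolding shift_up[OF len_pos, symmetric] image_insert image_set_diff[OF inj_emb] by simp
qed

text \<open>Only z can be a lattice cell on two sides, qo and qs, and the order of the tests in
  \<open>zone\<close> then gives it to qo. Without z the side qs has one cell fewer than blocks, and
  w fills this gap.\<close>

lemma zone_diagonal:
  assumes only: "\<And>p. p \<in> lattice \<epsilon> u \<Longrightarrow> inner Lft p \<or> inner Rgt p \<Longrightarrow> inner Bot p \<or> inner Top p \<Longrightarrow> p = z"
    and z: "inner qo z" "\<And>\<kappa>. z \<in> lattice \<epsilon> u \<Longrightarrow> zone \<kappa> True True z = Some qo" "\<And>q. inner q z \<longleftrightarrow> q = qo \<or> q = qs"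
    and "qo \<noteq> qs" and w: "w \<in> K"
  shows "{p \<in> lattice \<epsilon> u \<union> K. zone (\<lambda>p. if p = w then Some qs else None) True True p = Some q} =
    (if q = qs then insert w ({p \<in> lattice \<epsilon> u. inner q p} - {z}) else {p \<in> lattice \<epsilon> u. inner q p})"
proof -
  let ?\<kappa> = "\<lambda>p. if p = w then Some qs else None"
  have seven: "7 * int a \<noteq> 1" "7 * int b \<noteq> 1" by presburger+
  have "zone ?\<kappa> True True p = Some q \<longleftrightarrow> inner q p \<and> (p = z \<longrightarrow> q \<noteq> qs)" if p: "p \<in> lattice \<epsilon> u" for p
  proof (cases "p = z")
    case True
    then show ?thesis using z(2)[of ?\<kappa>] z(3)[of q] p \<open>qo \<noteq> qs\<close> by auto
  next
    case False
    have ne: "\<not> (inner Lft p \<and> inner Rgt p)" "\<not> (inner Bot p \<and> inner Top p)" using seven by auto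
    show ?thesis using False only[OF p] ne unfolding zone_lattice[OF p]
      by (cases q) (auto simp del: inner.simps)
  qed
  then have "{p \<in> lattice \<epsilon> u. zone ?\<kappa> True True p = Some q} = {p \<in> lattice \<epsilon> u. inner q p \<and> (p = z \<longrightarrow> q \<noteq> qs)}"
    by blast
  moreover have "{p \<in> K. ?\<kappa> p = Some q} = (if q = qs then {w} else {})" using w by auto
  ultimately show ?thesis unfolding zone_Some by auto
qed

lemma K_simps: "(0, 0) \<in> K" "(W, 0) \<in> K" "(0, H) \<in> K" "(W, H) \<in> K"
  by (auto simp: K_def)

lemma corner_only:
  assumes p: "p \<in> lattice \<epsilon> u" "inner Lft p \<or> inner Rgt p" "inner Bot p \<or> inner Top p"
  shows "p = (7 * int a, 7 * int b) \<and> u mod 7 = 0 \<or> p = (1, 7 * int b) \<and> u mod 7 = 1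
    \<or> p = (7 * int a, 1) \<and> u mod 7 = (2 * \<epsilon>) mod 7 \<or> p = (1, 1) \<and> u mod 7 = (1 + 2 * \<epsilon>) mod 7"
  using lattice_mod[OF p(1)] p(2,3) by (cases p) (elim disjE; simp)

text \<open>The guard at the corner w of the grid is handed from side qt to side qs. The inner corners z and z'
  are served by qo and qo', so that w takes their place on qs and qt.\<close>

lemma step_diagonal:
  assumes D: "config 1 t D"
    and S: "\<And>q. S q \<in> {1..7} \<and> row 1 t q (S q)" and T: "\<And>q. T q \<in> {1..7} \<and> row (-1) s q (T q)"
    and cross: "cross_x t s" "cross_y t s" and "w \<in> K" "qs \<noteq> qt"
    and only: "\<And>p. p \<in> lattice 1 t \<Longrightarrow> inner Lft p \<or> inner Rgt p \<Longrightarrow> inner Bot p \<or> inner Top p \<Longrightarrow> p = z"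
      "\<And>p. p \<in> lattice (-1) s \<Longrightarrow> inner Lft p \<or> inner Rgt p \<Longrightarrow> inner Bot p \<or> inner Top p \<Longrightarrow> p = z'"
    and z: "\<And>\<kappa>. z \<in> lattice 1 t \<Longrightarrow> zone \<kappa> True True z = Some qo"
      "\<And>q. inner q z \<longleftrightarrow> q = qo \<or> q = qs" "qo \<noteq> qs"
    and z': "\<And>\<kappa>. z' \<in> lattice (-1) s \<Longrightarrow> zone \<kappa> True True z' = Some qo'"
      "\<And>q. inner q z' \<longleftrightarrow> q = qo' \<or> q = qt" "qo' \<noteq> qt"
    and src: "passage qs (insert w ({p \<in> lattice 1 t. inner qs p} - {z}))
      {p \<in> lattice (-1) s. inner qs p} (S qs) (T qs)"
    and tgt: "passage qt {p \<in> lattice 1 t. inner qt p}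
      (insert w ({p \<in> lattice (-1) s. inner qt p} - {z'})) (S qt) (T qt)"
  shows "\<exists>D'. config (-1) s D' \<and> king_move D D'"
proof -
  let ?z = "zone (\<lambda>p. if p = w then Some qs else None) True True"
  let ?z' = "zone (\<lambda>p. if p = w then Some qt else None) True True"
  have zs: "{p \<in> lattice 1 t \<union> K. ?z p = Some q} =
      (if q = qs then insert w ({p \<in> lattice 1 t. inner q p} - {z}) else {p \<in> lattice 1 t. inner q p})" for q
    by (rule zone_diagonal[OF only(1) _ z \<open>w \<in> K\<close>]) (simp_all only: z(2), simp)
  have zt: "{p \<in> lattice (-1) s \<union> K. ?z' p = Some q} =
      (if q = qt then insert w ({p \<in> lattice (-1) s. inner q p} - {z'}) else {p \<in> lattice (-1) s. inner q p})" for q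
    by (rule zone_diagonal[OF only(2) _ z' \<open>w \<in> K\<close>]) (simp_all only: z'(2), simp)
  show ?thesis
  proof (rule assemble[OF D S T, where lab = ?z and lab' = ?z'])
    show "king_move {g \<in> lattice 1 t \<union> K. ?z g = None} {h \<in> lattice (-1) s \<union> K. ?z' h = None}"
      using zone_rest[of "\<lambda>p. if p = w then Some qs else None" "\<lambda>p. if p = w then Some qt else None" t s] cross
      by simp
    show "passage q {g \<in> lattice 1 t \<union> K. ?z g = Some q} {h \<in> lattice (-1) s \<union> K. ?z' h = Some q} (S q) (T q)" for q
      using src tgt passage_full[of t q "S q" s "T q"] S T \<open>qs \<noteq> qt\<close> unfolding zs zt by auto
  qed
qed

lemma passage_source_down:
  assumes "exchange 7 T 0 T" "row 1 t q 7" "row (-1) s q T" "T \<in> {1..7}"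
  shows "passage q (insert (emb q (0, 0)) ({p \<in> lattice 1 t. inner q p} - {emb q (7 * int (len q), 1)}))
    {p \<in> lattice (-1) s. inner q p} 7 T"
  unfolding inner_shift_down[OF assms(2) disjI1[OF refl]] inner_lattice[OF assms(3,4) disjI2[OF refl]] passage_def
  by (intro disjI2 exI[of _ 0] exI[of _ T] exI[of _ "\<lambda>k. if k = 0 then 0 else 1"] exI[of _ "\<lambda>_. 1"])
    (use assms(1) in auto)

lemma passage_source_up:
  assumes "exchange 1 T 8 T" "row 1 t q 1" "row (-1) s q T" "T \<in> {1..7}"
  shows "passage q (insert (emb q (7 * int (len q) + 1, 0)) ({p \<in> lattice 1 t. inner q p} - {emb q (1, 1)}))
    {p \<in> lattice (-1) s. inner q p} 1 T"
  unfolding inner_shift_up[OF assms(2) disjI1[OF refl]] inner_lattice[OF assms(3,4) disjI2[OF refl]] passage_def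
  by (intro disjI2 exI[of _ 8] exI[of _ T] exI[of _ "\<lambda>k. if k = len q - 1 then 0 else 1"] exI[of _ "\<lambda>_. 1"])
    (use assms(1) in auto)

lemma passage_target_up:
  assumes "exchange S 1 S 8" "row 1 t q S" "S \<in> {1..7}" "row (-1) s q 1"
  shows "passage q {p \<in> lattice 1 t. inner q p}
    (insert (emb q (7 * int (len q) + 1, 0)) ({p \<in> lattice (-1) s. inner q p} - {emb q (1, 1)})) S 1"
  unfolding inner_shift_up[OF assms(4) disjI2[OF refl]] inner_lattice[OF assms(2,3) disjI1[OF refl]] passage_def
  by (intro disjI2 exI[of _ S] exI[of _ 8] exI[of _ "\<lambda>_. 1"] exI[of _ "\<lambda>k. if k = len q - 1 then 0 else 1"])
    (use assms(1) in auto)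

text \<open>The corner of the box that can lie on the old lattice is (7a, 7b), shared by Top and
  Rgt; on the new lattice it is (1, 1), shared by Lft and Bot. Serving them by Top and Lft leaves
  Rgt one source short and Bot one target short. Both gaps are closed at the grid corner (W, 0)
  between Bot and Rgt: Bot delivers a guard there and Rgt takes the guard that was there.\<close>

lemma step_diagonal1:
  assumes D: "config 1 t D" and ts: "t mod 7 = 0" "s mod 7 = 6"
  shows "\<exists>D'. config (-1) s D' \<and> king_move D D'"
proof -
  obtain k where t: "t = 7 * k" using ts(1) by auto
  obtain l where s: "s = 7 * l + 6" using ts(2) by (metis mult_div_mod_eq)
  \<comment> \<open>The values of \<open>S\<close> and \<open>T\<close> solve the congruences
    \<open>row\<close> for t = 0 and s = 6 modulo 7.\<close>
  define S :: "side \<Rightarrow> int" where "S q = (case q of Lft \<Rightarrow> 3 | Bot \<Rightarrow> 5 | Rgt \<Rightarrow> 7 | Top \<Rightarrow> 7)" for q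
  define T :: "side \<Rightarrow> int" where "T q = (case q of Lft \<Rightarrow> 1 | Bot \<Rightarrow> 1 | Rgt \<Rightarrow> 4 | Top \<Rightarrow> 6)" for q
  have S: "S q \<in> {1..7} \<and> row 1 t q (S q)" for q unfolding S_def t by (cases q; simp; presburger)
  have T: "T q \<in> {1..7} \<and> row (-1) s q (T q)" for q unfolding T_def s by (cases q; simp; presburger)
  have "(s + t) mod 7 = 6" "(s - t) mod 7 = 6" unfolding t s by presburger+
  then have cross: "cross_x t s" "cross_y t s" unfolding cross_x_def cross_y_def by simp_all
  have seven: "7 * int a \<noteq> 1" "7 * int b \<noteq> 1" by presburger+
  show ?thesis
  proof (rule step_diagonal[OF D S T cross, where w = "(W, 0)" and qs = Rgt and qt = Bot
        and z = "(7 * int a, 7 * int b)" and z' = "(1, 1)" and qo = Top and qo' = Lft])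
    show "p = (7 * int a, 7 * int b)"
      if "p \<in> lattice 1 t" "inner Lft p \<or> inner Rgt p" "inner Bot p \<or> inner Top p" for p
      using corner_only[OF that] ts(1) by auto
    show "p = (1, 1)"
      if "p \<in> lattice (-1) s" "inner Lft p \<or> inner Rgt p" "inner Bot p \<or> inner Top p" for p
      using corner_only[OF that] ts(2) by auto
    show "zone \<kappa> True True (7 * int a, 7 * int b) = Some Top" if "(7 * int a, 7 * int b) \<in> lattice 1 t" for \<kappa>
      using seven unfolding zone_lattice[OF that] by simp
    show "zone \<kappa> True True (1, 1) = Some Lft" if "(1, 1) \<in> lattice (-1) s" for \<kappa>
      using seven unfolding zone_lattice[OF that] by simp
    show "inner q (7 * int a, 7 * int b) \<longleftrightarrow> q = Top \<or> q = Rgt" for q using seven by (cases q) auto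
    show "inner q (1, 1) \<longleftrightarrow> q = Lft \<or> q = Bot" for q using seven by (cases q) auto
    show "passage Rgt (insert (W, 0) ({p \<in> lattice 1 t. inner Rgt p} - {(7 * int a, 7 * int b)}))
        {p \<in> lattice (-1) s. inner Rgt p} (S Rgt) (T Rgt)"
      using passage_source_down[of 4 t Rgt s] exchange_special S[of Rgt] T[of Rgt] by (simp add: S_def T_def W_def)
    show "passage Bot {p \<in> lattice 1 t. inner Bot p}
        (insert (W, 0) ({p \<in> lattice (-1) s. inner Bot p} - {(1, 1)})) (S Bot) (T Bot)"
      using passage_target_up[of 5 t Bot s] exchange_special S[of Bot] T[of Bot] by (simp add: S_def T_def W_def)
  qed (simp_all add: K_simps)
qed

text \<open>Here the shared corners of the box are (1, 7b), served by Lft, and (7a, 1), served by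
  Bot. Top is one source short and Rgt one target short, so the surplus passes through the grid
  corner (W, H).\<close>

lemma step_diagonal2:
  assumes D: "config 1 t D" and ts: "t mod 7 = 1" "s mod 7 = 5"
  shows "\<exists>D'. config (-1) s D' \<and> king_move D D'"
proof -
  obtain k where t: "t = 7 * k + 1" using ts(1) by (metis mult_div_mod_eq)
  obtain l where s: "s = 7 * l + 5" using ts(2) by (metis mult_div_mod_eq)
  define S :: "side \<Rightarrow> int" where "S q = (case q of Lft \<Rightarrow> 7 | Bot \<Rightarrow> 6 | Rgt \<Rightarrow> 4 | Top \<Rightarrow> 1)" for q
  define T :: "side \<Rightarrow> int" where "T q = (case q of Lft \<Rightarrow> 5 | Bot \<Rightarrow> 7 | Rgt \<Rightarrow> 1 | Top \<Rightarrow> 5)" for q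
  have S: "S q \<in> {1..7} \<and> row 1 t q (S q)" for q unfolding S_def t by (cases q; simp; presburger)
  have T: "T q \<in> {1..7} \<and> row (-1) s q (T q)" for q unfolding T_def s by (cases q; simp; presburger)
  have "(s + t) mod 7 = 6" "(s - t) mod 7 = 4" unfolding t s by presburger+
  then have cross: "cross_x t s" "cross_y t s" unfolding cross_x_def cross_y_def by simp_all
  have seven: "7 * int a \<noteq> 1" "7 * int b \<noteq> 1" by presburger+
  show ?thesis
  proof (rule step_diagonal[OF D S T cross, where w = "(W, H)" and qs = Top and qt = Rgt
        and z = "(1, 7 * int b)" and z' = "(7 * int a, 1)" and qo = Lft and qo' = Bot])
    show "p = (1, 7 * int b)"
      if "p \<in> lattice 1 t" "inner Lft p \<or> inner Rgt p" "inner Bot p \<or> inner Top p" for p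
      using corner_only[OF that] ts(1) by auto
    show "p = (7 * int a, 1)"
      if "p \<in> lattice (-1) s" "inner Lft p \<or> inner Rgt p" "inner Bot p \<or> inner Top p" for p
      using corner_only[OF that] ts(2) by auto
    show "zone \<kappa> True True (1, 7 * int b) = Some Lft" if "(1, 7 * int b) \<in> lattice 1 t" for \<kappa>
      using seven unfolding zone_lattice[OF that] by simp
    show "zone \<kappa> True True (7 * int a, 1) = Some Bot" if "(7 * int a, 1) \<in> lattice (-1) s" for \<kappa>
      using seven unfolding zone_lattice[OF that] by simp
    show "inner q (1, 7 * int b) \<longleftrightarrow> q = Lft \<or> q = Top" for q using seven by (cases q) auto
    show "inner q (7 * int a, 1) \<longleftrightarrow> q = Bot \<or> q = Rgt" for q using seven by (cases q) auto
    show "passage Top (insert (W, H) ({p \<in> lattice 1 t. inner Top p} - {(1, 7 * int b)}))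
        {p \<in> lattice (-1) s. inner Top p} (S Top) (T Top)"
      using passage_source_up[of 5 t Top s] exchange_special S[of Top] T[of Top]
      by (simp add: S_def T_def W_def H_def)
    show "passage Rgt {p \<in> lattice 1 t. inner Rgt p}
        (insert (W, H) ({p \<in> lattice (-1) s. inner Rgt p} - {(7 * int a, 1)})) (S Rgt) (T Rgt)"
      using passage_target_up[of 4 t Rgt s] exchange_special S[of Rgt] T[of Rgt]
      by (simp add: S_def T_def W_def H_def)
  qed (simp_all add: K_simps)
qed


section \<open>The strategy\<close>

definition flip_x :: "int \<times> int \<Rightarrow> int \<times> int" where "flip_x p = (W - fst p, snd p)"
definition flip_y :: "int \<times> int \<Rightarrow> int \<times> int" where "flip_y p = (fst p, H - snd p)"

text \<open>A reflection carries a block to the opposite side with its rows kept, or to a block of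
  the same side with its rows reversed. These are the two alternatives for \<rho>; in the second one
  \<open>pattern_reflect\<close> supplies the new pattern.\<close>

lemma config_flip:
  assumes D: "config \<epsilon> t D" and inv: "\<And>p. \<rho> (\<rho> p) = p"
    and sets: "\<And>p. \<rho> p \<in> V \<longleftrightarrow> p \<in> V" "\<And>p. \<rho> p \<in> K \<longleftrightarrow> p \<in> K" "\<And>p. \<rho> p \<in> I \<longleftrightarrow> p \<in> I"
    and lat: "\<And>p. \<rho> p \<in> lattice \<epsilon> t \<longleftrightarrow> p \<in> lattice \<epsilon>' t'"
    and blocks: "\<And>q k. k < len q \<Longrightarrow> \<exists>q' k'. k' < len q' \<and>
      ((\<forall>j d. \<rho> (emb q (7 * int k + j, d)) = emb q' (7 * int k' + j, d)) \<or>
       (\<forall>j d. \<rho> (emb q (7 * int k + j, d)) = emb q' (7 * int k' + (8 - j), d)))"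
  shows "config \<epsilon>' t' (\<rho> ` D)"
proof -
  have mem: "p \<in> \<rho> ` D \<longleftrightarrow> \<rho> p \<in> D" for p using inv by (metis image_iff)
  have D': "D \<subseteq> V" "K \<subseteq> D" "D \<inter> I = lattice \<epsilon> t"
    "\<And>q k. k < len q \<Longrightarrow> \<exists>S\<in>{1..7}. emb q (7 * int k + S, 1) \<in> D \<and>
        (\<exists>xs\<in>set (patterns S). \<forall>j\<in>{1..7}. emb q (7 * int k + j, 0) \<in> D \<longleftrightarrow> j \<in> set xs)"
    using D unfolding config_def by blast+
  have "\<rho> ` D \<subseteq> V" using D'(1) sets(1) by blast
  moreover have "K \<subseteq> \<rho> ` D"
  proof
    fix p assume "p \<in> K"
    then have "\<rho> p \<in> K" by (simp only: sets(2))
    then show "p \<in> \<rho> ` D" unfolding mem using D'(2) by blast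
  qed
  moreover have "\<rho> ` D \<inter> I = lattice \<epsilon>' t'"
  proof (rule set_eqI)
    fix p
    have "\<rho> p \<in> D \<and> \<rho> p \<in> I \<longleftrightarrow> \<rho> p \<in> lattice \<epsilon> t" using D'(3) by blast
    then show "p \<in> \<rho> ` D \<inter> I \<longleftrightarrow> p \<in> lattice \<epsilon>' t'" by (simp add: mem sets(3) lat)
  qed
  moreover have "\<exists>S\<in>{1..7}. emb q (7 * int k + S, 1) \<in> \<rho> ` D \<and>
      (\<exists>xs\<in>set (patterns S). \<forall>j\<in>{1..7}. emb q (7 * int k + j, 0) \<in> \<rho> ` D \<longleftrightarrow> j \<in> set xs)" if k: "k < len q" for q k
  proof -
    obtain q' k' where k': "k' < len q'" and or: "(\<forall>j d. \<rho> (emb q (7 * int k + j, d)) = emb q' (7 * int k' + j, d)) \<or>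
       (\<forall>j d. \<rho> (emb q (7 * int k + j, d)) = emb q' (7 * int k' + (8 - j), d))"
      using blocks[OF k] by blast
    obtain S xs where S: "S \<in> {1..7}" "emb q' (7 * int k' + S, 1) \<in> D" and xs: "xs \<in> set (patterns S)"
      "\<And>j. j \<in> {1..7} \<Longrightarrow> emb q' (7 * int k' + j, 0) \<in> D \<longleftrightarrow> j \<in> set xs"
      using D'(4)[OF k'] by blast
    from or show ?thesis
    proof
      assume "\<forall>j d. \<rho> (emb q (7 * int k + j, d)) = emb q' (7 * int k' + j, d)"
      then show ?thesis using S xs by (auto simp: mem)
    next
      assume *: "\<forall>j d. \<rho> (emb q (7 * int k + j, d)) = emb q' (7 * int k' + (8 - j), d)"
      obtain ys where ys: "ys \<in> set (patterns (8 - S))" "set ys = (\<lambda>j. 8 - j) ` set xs"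
        using pattern_reflect S(1) xs(1) by blast
      have "emb q (7 * int k + j, 0) \<in> \<rho> ` D \<longleftrightarrow> j \<in> set ys" if "j \<in> {1..7}" for j
      proof -
        have "8 - j \<in> {1..7}" using that by auto
        moreover have "8 - j \<in> set xs \<longleftrightarrow> j \<in> set ys" unfolding ys(2) by (auto intro: rev_image_eqI)
        ultimately show ?thesis using xs(2) by (simp add: mem *)
      qed
      moreover have "emb q (7 * int k + (8 - S), 1) \<in> \<rho> ` D" using S(2) by (simp add: mem *)
      moreover have "8 - S \<in> {1..7}" using S(1) by auto
      ultimately show ?thesis using ys(1) by blast
    qed
  qed
  ultimately show ?thesis unfolding config_def by (intro conjI allI impI)
qed

lemma config_flip_x:
  assumes "config \<epsilon> t D"
  shows "config (- \<epsilon>) (W - t) (flip_x ` D)"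
proof (rule config_flip[OF assms])
  fix p
  show "flip_x (flip_x p) = p" by (simp add: flip_x_def)
  show "flip_x p \<in> V \<longleftrightarrow> p \<in> V" "flip_x p \<in> K \<longleftrightarrow> p \<in> K" "flip_x p \<in> I \<longleftrightarrow> p \<in> I"
    by (cases p; auto simp: flip_x_def V_def K_def I_def W_def)+
  moreover have "fst (flip_x p) + 2 * \<epsilon> * snd (flip_x p) - t = - (fst p + 2 * - \<epsilon> * snd p - (W - t))"
    by (simp add: flip_x_def)
  ultimately show "flip_x p \<in> lattice \<epsilon> t \<longleftrightarrow> p \<in> lattice (- \<epsilon>) (W - t)"
    unfolding lattice_def by (simp only: mem_Collect_eq dvd_minus_iff)
next
  fix q k assume k: "k < len q"
  show "\<exists>q' k'. k' < len q' \<and>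
      ((\<forall>j d. flip_x (emb q (7 * int k + j, d)) = emb q' (7 * int k' + j, d)) \<or>
       (\<forall>j d. flip_x (emb q (7 * int k + j, d)) = emb q' (7 * int k' + (8 - j), d)))"
  proof (cases q)
    case Lft then show ?thesis using k by (intro exI[of _ Rgt] exI[of _ k]) (simp add: flip_x_def)
  next
    case Rgt then show ?thesis using k by (intro exI[of _ Lft] exI[of _ k]) (simp add: flip_x_def)
  next
    case Bot then show ?thesis using k
      by (intro exI[of _ Bot] exI[of _ "a - 1 - k"]) (auto simp: flip_x_def W_def of_nat_diff)
  next
    case Top then show ?thesis using k
      by (intro exI[of _ Top] exI[of _ "a - 1 - k"]) (auto simp: flip_x_def W_def of_nat_diff)
  qed
qed

lemma config_flip_y:
  assumes "config \<epsilon> t D"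
  shows "config (- \<epsilon>) (t - 2 * \<epsilon> * H) (flip_y ` D)"
proof (rule config_flip[OF assms])
  fix p
  show "flip_y (flip_y p) = p" by (simp add: flip_y_def)
  show "flip_y p \<in> V \<longleftrightarrow> p \<in> V" "flip_y p \<in> K \<longleftrightarrow> p \<in> K" "flip_y p \<in> I \<longleftrightarrow> p \<in> I"
    by (cases p; auto simp: flip_y_def V_def K_def I_def H_def)+
  moreover have "fst (flip_y p) + 2 * \<epsilon> * snd (flip_y p) - t = fst p + 2 * - \<epsilon> * snd p - (t - 2 * \<epsilon> * H)"
    by (simp add: flip_y_def algebra_simps)
  ultimately show "flip_y p \<in> lattice \<epsilon> t \<longleftrightarrow> p \<in> lattice (- \<epsilon>) (t - 2 * \<epsilon> * H)"
    unfolding lattice_def by (simp only: mem_Collect_eq)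
next
  fix q k assume k: "k < len q"
  show "\<exists>q' k'. k' < len q' \<and>
      ((\<forall>j d. flip_y (emb q (7 * int k + j, d)) = emb q' (7 * int k' + j, d)) \<or>
       (\<forall>j d. flip_y (emb q (7 * int k + j, d)) = emb q' (7 * int k' + (8 - j), d)))"
  proof (cases q)
    case Bot then show ?thesis using k by (intro exI[of _ Top] exI[of _ k]) (simp add: flip_y_def)
  next
    case Top then show ?thesis using k by (intro exI[of _ Bot] exI[of _ k]) (simp add: flip_y_def)
  next
    case Lft then show ?thesis using k
      by (intro exI[of _ Lft] exI[of _ "b - 1 - k"]) (auto simp: flip_y_def H_def of_nat_diff)
  next
    case Rgt then show ?thesis using k
      by (intro exI[of _ Rgt] exI[of _ "b - 1 - k"]) (auto simp: flip_y_def H_def of_nat_diff)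
  qed
qed

lemma flip_image [simp]: "flip_x ` flip_x ` D = D" "flip_y ` flip_y ` D = D"
  by (simp_all add: image_image flip_x_def flip_y_def)

lemma king_move_flip_x: "king_move D D' \<Longrightarrow> king_move (flip_x ` D) (flip_x ` D')"
  by (rule king_move_image) (auto simp: near_def flip_x_def inj_def)

lemma king_move_flip_y: "king_move D D' \<Longrightarrow> king_move (flip_y ` D) (flip_y ` D')"
  by (rule king_move_image) (auto simp: near_def flip_y_def inj_def)

text \<open>The half turn of the grid keeps both slopes and sends t to 3 - t and s to -1 - s modulo
  7, as W and H are congruent to 1. It takes the diagonal pair (3,0) to (0,6) and (2,1) to (1,5), so
  two of the four diagonal cases follow from the other two.\<close>

lemma step:
  assumes D: "config 1 t D"
  shows "\<exists>D'. config (-1) s D' \<and> king_move D D'"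
proof -
  consider "\<not> diagonal t s" | "t mod 7 = 0 \<and> s mod 7 = 6 \<or> t mod 7 = 1 \<and> s mod 7 = 5"
    | "t mod 7 = 3 \<and> s mod 7 = 0 \<or> t mod 7 = 2 \<and> s mod 7 = 1"
    unfolding diagonal_def by simp metis
  then show ?thesis
  proof cases
    case 1 then show ?thesis using step_generic D by blast
  next
    case 2
    then show ?thesis
      by (elim disjE conjE) (rule step_diagonal1[OF D] step_diagonal2[OF D]; assumption)+
  next
    case 3
    define t' where "t' = W - (t - 2 * H)"
    define s' where "s' = W - 2 * H - s"
    have "config 1 t' (flip_x ` flip_y ` D)"
      using config_flip_x[OF config_flip_y[OF D]] by (simp add: t'_def)
    moreover have "t' = 3 - t + 7 * (int a + 2 * int b)" "s' = -1 - s + 7 * (int a - 2 * int b)"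
      by (simp_all add: t'_def s'_def W_def H_def)
    then have "t' mod 7 = (3 - t) mod 7" "s' mod 7 = (-1 - s) mod 7" by (metis mod_mult_self2)+
    then have "t' mod 7 = (3 - t mod 7) mod 7" "s' mod 7 = (-1 - s mod 7) mod 7"
      by (simp_all add: mod_diff_right_eq)
    then have "t' mod 7 = 0 \<and> s' mod 7 = 6 \<or> t' mod 7 = 1 \<and> s' mod 7 = 5"
      using 3 by (elim disjE conjE) simp_all
    ultimately obtain E where E: "config (-1) s' E" "king_move (flip_x ` flip_y ` D) E"
      using step_diagonal1[of t' _ s'] step_diagonal2[of t' _ s'] by metis
    have "config (-1) s (flip_x ` flip_y ` E)"
      using config_flip_x[OF config_flip_y[OF E(1)]] by (simp add: s'_def)
    moreover have "king_move D (flip_y ` flip_x ` E)"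
      using king_move_flip_y[OF king_move_flip_x[OF E(2)]] by simp
    moreover have "flip_y ` flip_x ` E = flip_x ` flip_y ` E"
      by (simp add: image_image flip_x_def flip_y_def)
    ultimately show ?thesis by auto
  qed
qed

lemma step_attack:
  assumes D: "config \<epsilon> t D" and \<epsilon>: "\<epsilon> = 1 \<or> \<epsilon> = -1" and v: "v \<in> I"
  shows "\<exists>t' D'. config (- \<epsilon>) t' D' \<and> king_move D D' \<and> v \<in> D'"
  using \<epsilon>
proof
  have in_lattice: "v \<in> D'" if "config (-1) (fst v - 2 * snd v) D'" "v \<in> I" for v D'
  proof -
    have "v \<in> lattice (-1) (fst v - 2 * snd v)" using that(2) by (simp add: lattice_def)
    then show ?thesis using that(1) unfolding config_def by blast
  qed
  {
    assume "\<epsilon> = 1"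
    then show ?thesis using step[of t D "fst v - 2 * snd v"] D in_lattice[OF _ v] by auto
  next
    assume e: "\<epsilon> = -1"
    \<comment> \<open>The reflection in y exchanges the slopes: the response is found for the
      reflected attack and reflected back.\<close>
    let ?v = "flip_y v"
    have "?v \<in> I" using v by (cases v) (auto simp: flip_y_def I_def H_def)
    moreover have "config 1 (t + 2 * H) (flip_y ` D)" using config_flip_y[OF D] e by simp
    then obtain E where E: "config (-1) (fst ?v - 2 * snd ?v) E" "king_move (flip_y ` D) E" using step by blast
    ultimately have "?v \<in> E" using in_lattice by blast
    then have "v \<in> flip_y ` E" by (intro image_eqI[of _ _ ?v]) (simp_all add: flip_y_def)
    moreover have "king_move D (flip_y ` E)" using king_move_flip_y[OF E(2)] by simp
    ultimately show ?thesis using config_flip_y[OF E(1)] e by auto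
  }
qed

text \<open>Only the border guards of the attacked block and the lattice guard beside it move, and
  they occupy the same inner cell again. The lattice and the patterns of all other blocks are
  therefore unchanged.\<close>

lemma border_attack:
  assumes D: "config \<epsilon> t D" and v: "v \<in> edge q"
  shows "\<exists>D'. config \<epsilon> t D' \<and> king_move D D' \<and> v \<in> D'"
proof -
  obtain k i where k: "k < len q" and i: "i \<in> {1..7}" and vi: "v = emb q (7 * int k + i, 0)"
    using v by (rule edge_coord)
  have D': "D \<subseteq> V" "K \<subseteq> D" "D \<inter> I = lattice \<epsilon> t"
    "\<And>q k. k < len q \<Longrightarrow> \<exists>S\<in>{1..7}. emb q (7 * int k + S, 1) \<in> D \<and>
        (\<exists>xs\<in>set (patterns S). \<forall>j\<in>{1..7}. emb q (7 * int k + j, 0) \<in> D \<longleftrightarrow> j \<in> set xs)"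
    using D unfolding config_def by blast+
  obtain S xs where S: "S \<in> {1..7}" "emb q (7 * int k + S, 1) \<in> D" and xs: "xs \<in> set (patterns S)"
    "\<And>j. j \<in> {1..7} \<Longrightarrow> emb q (7 * int k + j, 0) \<in> D \<longleftrightarrow> j \<in> set xs"
    using D'(4)[OF k] by blast
  obtain ys where ys: "ys \<in> set (patterns S)" "i \<in> set ys" "close (insort S xs) (insort S ys)"
    using pattern_attack S(1) i xs(1) by blast
  have rows: "distinct xs" "set xs \<subseteq> {1..7}" "distinct ys" "set ys \<subseteq> {1..7}"
    using pattern_rows S(1) xs(1) ys(1) by blast+
  define cell where "cell j = emb q (7 * int k + j, 0)" for j
  define e where "e = emb q (7 * int k + S, 1)"
  define C where "C = cell ` {1..7}"
  define E where "E = (D - C) \<union> cell ` set ys"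
  have cell_edge: "cell j \<in> edge q" if "j \<in> {1..7}" for j unfolding cell_def by (rule emb_edge[OF k that])
  have inj_cell: "cell j = cell l \<longleftrightarrow> j = l" for j l unfolding cell_def by (simp add: inj_eq[OF inj_emb])
  have C_edge: "C \<subseteq> edge q" unfolding C_def using cell_edge by blast
  have CKI: "C \<inter> K = {}" "C \<inter> I = {}" using C_edge edge_KI[of _ q] by auto
  have ysC: "cell ` set ys \<subseteq> C" unfolding C_def using rows(4) by blast
  have "e \<in> I" unfolding e_def by (rule emb_I[OF k S(1)])
  then have "e \<notin> C" using CKI(2) by blast
  have DC: "D \<inter> C = cell ` set xs"
    unfolding C_def using xs(2) rows(2) by (auto simp: cell_def)
  have "king_move (emb q ` insert (7 * int k + S, 1) ((\<lambda>j. (7 * int k + j, 0)) ` set xs))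
      (emb q ` insert (7 * int k + S, 1) ((\<lambda>j. (7 * int k + j, 0)) ` set ys))"
    by (intro king_move_image[OF _ near_emb inj_emb] block_king_move) (use ys(3) rows in auto)
  then have "king_move (insert e (cell ` set xs)) (insert e (cell ` set ys))"
    by (simp add: image_image e_def cell_def)
  moreover have "(D - C - {e}) \<inter> insert e (cell ` set xs) = {}" "(D - C - {e}) \<inter> insert e (cell ` set ys) = {}"
    using DC ysC by blast+
  ultimately have "king_move ((D - C - {e}) \<union> insert e (cell ` set xs)) ((D - C - {e}) \<union> insert e (cell ` set ys))"
    by (intro king_move_Un[OF king_move_refl])
  moreover have "(D - C - {e}) \<union> insert e (cell ` set xs) = D" using DC S(2) unfolding e_def by blast
  moreover have "(D - C - {e}) \<union> insert e (cell ` set ys) = E"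
    using S(2) \<open>e \<notin> C\<close> unfolding E_def e_def by blast
  ultimately have "king_move D E" by simp
  moreover have "v \<in> E" unfolding E_def vi using ys(2) by (auto simp: cell_def)
  moreover have "config \<epsilon> t E"
  proof -
    have "E \<subseteq> V" using D'(1) ysC C_edge subset_V(3)[of q] unfolding E_def by blast
    moreover have "K \<subseteq> E" using D'(2) CKI unfolding E_def by blast
    moreover have "E \<inter> I = lattice \<epsilon> t" using D'(3) CKI ysC unfolding E_def by blast
    moreover have "\<exists>S\<in>{1..7}. emb q' (7 * int l + S, 1) \<in> E \<and>
        (\<exists>xs\<in>set (patterns S). \<forall>j\<in>{1..7}. emb q' (7 * int l + j, 0) \<in> E \<longleftrightarrow> j \<in> set xs)" if l: "l < len q'" for q' l
    proof (cases "q' = q \<and> l = k")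
      case True
      have "e \<in> E" using S(2) \<open>e \<notin> C\<close> unfolding E_def e_def by blast
      moreover have "cell j \<in> E \<longleftrightarrow> j \<in> set ys" if "j \<in> {1..7}" for j
        using that unfolding E_def C_def by (auto simp: inj_cell)
      ultimately show ?thesis using True S(1) ys(1) unfolding cell_def e_def by blast
    next
      case False
      obtain R zs where R: "R \<in> {1..7}" "emb q' (7 * int l + R, 1) \<in> D" and zs: "zs \<in> set (patterns R)"
        "\<And>j. j \<in> {1..7} \<Longrightarrow> emb q' (7 * int l + j, 0) \<in> D \<longleftrightarrow> j \<in> set zs"
        using D'(4)[OF l] by blast
      have "emb q' (7 * int l + R, 1) \<notin> C" using emb_I[OF l R(1)] CKI(2) by blast
      then have "emb q' (7 * int l + R, 1) \<in> E" using R(2) unfolding E_def by blast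
      moreover have "emb q' (7 * int l + j, 0) \<in> E \<longleftrightarrow> j \<in> set zs" if j: "j \<in> {1..7}" for j
      proof -
        have "emb q' (7 * int l + j, 0) \<notin> C"
        proof
          assume *: "emb q' (7 * int l + j, 0) \<in> C"
          then have "q' = q" using edge_disjoint emb_edge[OF l j] C_edge by blast
          moreover from * obtain j' where "j' \<in> {1..7}" "emb q' (7 * int l + j, 0) = cell j'"
            unfolding C_def by blast
          ultimately have "j' \<in> {1..7}" "7 * int l + j = 7 * int k + j'"
            by (simp_all add: cell_def inj_eq[OF inj_emb])
          then have "l = k" using block_unique(1)[OF j] by blast
          then show False using False \<open>q' = q\<close> by blast
        qed
        then show ?thesis using zs(2)[OF j] ysC unfolding E_def by blast
      qed
      ultimately show ?thesis using R(1) zs(1) by blast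
    qed
    ultimately show ?thesis unfolding config_def by (intro conjI allI impI)
  qed
  ultimately show ?thesis by blast
qed

definition reach :: "(int \<times> int) set \<Rightarrow> bool" where
  "reach D \<longleftrightarrow> (\<exists>\<epsilon> t. (\<epsilon> = 1 \<or> \<epsilon> = -1) \<and> config \<epsilon> t D)"

lemma respond:
  assumes "reach D" "v \<in> V"
  shows "\<exists>D'. reach D' \<and> king_move D D' \<and> v \<in> D'"
proof -
  obtain \<epsilon> t where \<epsilon>: "\<epsilon> = 1 \<or> \<epsilon> = -1" and D: "config \<epsilon> t D" using assms(1) unfolding reach_def by blast
  have minus: "- \<epsilon> = 1 \<or> - \<epsilon> = -1" using \<epsilon> by auto
  from assms(2) show ?thesis
  proof (cases rule: V_cases)
    case 1
    then have "v \<in> D" using D unfolding config_def by blast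
    then show ?thesis using assms(1) king_move_refl by blast
  next
    case 2
    then show ?thesis using step_attack[OF D \<epsilon>] minus unfolding reach_def by blast
  next
    case (3 q)
    then show ?thesis using border_attack[OF D] \<epsilon> unfolding reach_def by blast
  qed
qed

section \<open>Counting the guards\<close>

lemma card_lattice: "card (lattice 1 t) \<le> 7 * a * b"
proof -
  let ?f = "\<lambda>p. (fst p, (snd p - 1) div 7)"
  \<comment> \<open>Each column meets each run of seven rows in at most one lattice cell, because 2
    is invertible modulo 7.\<close>
  have "inj_on ?f (lattice 1 t)"
  proof (rule inj_onI)
    fix p p' assume p: "p \<in> lattice 1 t" "p' \<in> lattice 1 t" and eq: "?f p = ?f p'"
    then have x: "fst p = fst p'" and y: "(snd p - 1) div 7 = (snd p' - 1) div 7" by auto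
    have "7 dvd fst p + 2 * snd p - t" "7 dvd fst p' + 2 * snd p' - t"
      using p by (simp_all add: lattice_def)
    from dvd_diff[OF this] have "7 dvd 2 * (snd p - snd p')" using x by (simp add: algebra_simps)
    moreover have "coprime 7 (2 :: int)" by code_simp
    ultimately have "7 dvd snd p - snd p'" using coprime_dvd_mult_right_iff by blast
    then have "7 dvd (snd p - 1) - (snd p' - 1)" by simp
    then have "(snd p - 1) mod 7 = (snd p' - 1) mod 7" by (simp add: mod_eq_dvd_iff)
    with y have "snd p - 1 = snd p' - 1" by (metis mult_div_mod_eq)
    then have "snd p = snd p'" by simp
    then show "p = p'" using x by (simp add: prod_eq_iff)
  qed
  moreover have "?f ` lattice 1 t \<subseteq> {1..7 * int a} \<times> {0..<int b}"
    by (auto simp: lattice_def I_def)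
  ultimately have "card (lattice 1 t) \<le> card ({1..7 * int a} \<times> {0..<int b})"
    by (intro card_inj_on_le) auto
  then show ?thesis by (simp add: card_cartesian_product nat_mult_distrib)
qed

text \<open>The terms count the lattice cells, five guards for each of the 2(a + b) blocks, and the
  corners. An upper bound suffices: the game is played with the actual cardinality of the starting
  set.\<close>

lemma initial: "\<exists>D. reach D \<and> card D \<le> 7 * a * b + 10 * (a + b) + 4"
proof -
  obtain S where S: "\<And>q. S q \<in> {1..7} \<and> row 1 0 q (S q)" using row_exists[of 1 0] by metis
  define \<beta> where "\<beta> q k = hd (patterns (S q))" for q and k :: nat
  have \<beta>: "\<beta> q k \<in> set (patterns (S q))" for q k unfolding \<beta>_def using pattern_nonempty S by (intro hd_in_set) blast
  let ?B = "\<lambda>q. emb q ` border (len q) (\<beta> q)"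
  have B: "card (?B q) \<le> 5 * len q" for q
  proof -
    have "card ((\<lambda>j. (7 * int k + j, 0::int)) ` set (\<beta> q k)) \<le> 5" for k
    proof -
      have "length (\<beta> q k) = 5" using pattern_rows S[of q] \<beta>[of q k] by blast
      then show ?thesis using card_image_le[OF finite_set, of _ "\<beta> q k"] card_length[of "\<beta> q k"]
        by (metis le_trans)
    qed
    then have "card (border (len q) (\<beta> q)) \<le> (\<Sum>k<len q. 5)"
      unfolding border_def by (intro order_trans[OF card_UN_le] sum_mono) auto
    moreover have "finite (border (len q) (\<beta> q))" unfolding border_def by simp
    ultimately show ?thesis using card_image_le[of "border (len q) (\<beta> q)" "emb q"] by simp
  qed
  have U: "(\<Union>q. f q) = f Lft \<union> f Bot \<union> f Rgt \<union> f Top" for f :: "side \<Rightarrow> (int \<times> int) set"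
  proof (intro equalityI subsetI)
    fix p assume "p \<in> (\<Union>q. f q)"
    then obtain q where "p \<in> f q" by blast
    then show "p \<in> f Lft \<union> f Bot \<union> f Rgt \<union> f Top" by (cases q) blast+
  qed blast
  define N where "N = 7 * a * b"
  define X where "X q = ?B q" for q
  have X: "card (X q) \<le> 5 * len q" for q unfolding X_def by (rule B)
  have "card (\<Union>q. X q) \<le> 5 * b + 5 * a + 5 * b + 5 * a"
    using X[of Lft] X[of Bot] X[of Rgt] X[of Top] card_Un_le[of "X Lft" "X Bot"]
      card_Un_le[of "X Lft \<union> X Bot" "X Rgt"] card_Un_le[of "X Lft \<union> X Bot \<union> X Rgt" "X Top"]
    unfolding U[of X] len.simps by linarith
  moreover have "card K \<le> 4"
    unfolding K_def by (simp add: card_cartesian_product card_insert_if)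
  ultimately have "card (K \<union> lattice 1 0 \<union> (\<Union>q. X q)) \<le> N + 10 * (a + b) + 4"
    using card_lattice[of 0, folded N_def] card_Un_le[of K "lattice 1 0"]
      card_Un_le[of "K \<union> lattice 1 0" "\<Union>q. X q"]
    by (simp add: algebra_simps)
  moreover have "config 1 0 (K \<union> lattice 1 0 \<union> (\<Union>q. X q))"
    unfolding X_def by (rule configI[OF S \<beta>])
  then have "reach (K \<union> lattice 1 0 \<union> (\<Union>q. X q))" unfolding reach_def by blast
  ultimately show ?thesis unfolding N_def by blast
qed

lemma reach_V: "reach D \<Longrightarrow> D \<subseteq> V"
  unfolding reach_def config_def by blast

section \<open>From king moves in the integer plane to the game\<close>

definition to_int :: "nat \<times> nat \<Rightarrow> int \<times> int" where
  "to_int p = (int (fst p), int (snd p))"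

lemma to_int_V: "to_int p \<in> V \<longleftrightarrow> p \<in> grid_vertices (7 * a + 2) (7 * b + 2)"
  by (cases p) (auto simp: to_int_def V_def W_def H_def grid_vertices_def)

lemma bij_to_int: "D \<subseteq> V \<Longrightarrow> bij_betw to_int (to_int -` D) D"
proof (rule bij_betw_imageI)
  show "inj_on to_int (to_int -` D)" by (auto simp: inj_on_def to_int_def prod_eq_iff)
  assume "D \<subseteq> V"
  have "p \<in> range to_int" if "p \<in> V" for p
    using that by (intro range_eqI[of _ _ "(nat (fst p), nat (snd p))"]) (auto simp: to_int_def V_def)
  then show "to_int ` (to_int -` D) = D" using \<open>D \<subseteq> V\<close> by (auto simp: image_vimage_eq)
qed

lemma guard_move_vimage:
  assumes "king_move D D'" "D \<subseteq> V" "D' \<subseteq> V"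
  shows "guard_move strong_adj (to_int -` D) (to_int -` D')"
proof -
  obtain f where f: "bij_betw f D D'" "\<forall>x\<in>D. near x (f x)" using assms(1) unfolding king_move_def by blast
  let ?X = "to_int -` D'"
  define g where "g = the_inv_into ?X to_int"
  have X: "bij_betw to_int ?X D'" using assms(3) by (rule bij_to_int)
  have "bij_betw (g \<circ> (f \<circ> to_int)) (to_int -` D) ?X"
    unfolding g_def using bij_to_int[OF assms(2)] f(1) bij_betw_the_inv_into[OF X]
    by (intro bij_betw_trans)
  moreover have "(g \<circ> (f \<circ> to_int)) x = x \<or> strong_adj x ((g \<circ> (f \<circ> to_int)) x)" if x: "x \<in> to_int -` D" for x
  proof -
    have "f (to_int x) \<in> D'" using f(1) x by (auto simp: bij_betw_def)
    then have "to_int (g (f (to_int x))) = f (to_int x)"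
      unfolding g_def using X f_the_inv_into_f_bij_betw by metis
    then have "near (to_int x) (to_int (g (f (to_int x))))" using f(2) x by auto
    then show ?thesis by (auto simp: near_def to_int_def strong_adj_def prod_eq_iff)
  qed
  ultimately show ?thesis unfolding guard_move_def by blast
qed

lemma eternal_win:
  "\<exists>k \<le> 7 * a * b + 10 * (a + b) + 4. eternal_all_win (grid_vertices (7 * a + 2) (7 * b + 2)) strong_adj k"
proof -
  let ?V = "grid_vertices (7 * a + 2) (7 * b + 2)"
  obtain D0 where D0: "reach D0" "card D0 \<le> 7 * a * b + 10 * (a + b) + 4" using initial by blast
  \<comment> \<open>A fixed choice of responses, folded over the history of attacks, turns the
    step-by-step answers into a strategy.\<close>
  define answer where "answer D v = (SOME D'. reach D' \<and> king_move D D' \<and> to_int v \<in> D')" for D v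
  have answer: "reach (answer D v) \<and> king_move D (answer D v) \<and> to_int v \<in> answer D v" if "reach D" "v \<in> ?V" for D v
    unfolding answer_def by (rule someI_ex[OF respond]) (use that to_int_V in auto)
  define P where "P vs = foldl answer D0 vs" for vs
  define S where "S vs = to_int -` P vs" for vs
  have snoc: "P (vs @ [v]) = answer (P vs) v" for vs v by (simp add: P_def)
  have fin: "finite V" by (simp add: V_def)
  have reach: "reach (P vs) \<and> card (P vs) = card D0" if "vs \<in> lists ?V" for vs
    using that
  proof (induction vs rule: rev_induct)
    case Nil
    then show ?case using D0(1) by (simp add: P_def)
  next
    case (snoc v vs)
    then have "king_move (P vs) (P (vs @ [v]))" "reach (P (vs @ [v]))"
      using answer[of "P vs" v] by (simp_all add: \<open>\<And>vs v. P (vs @ [v]) = answer (P vs) v\<close>)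
    then show ?case using snoc by (auto simp: king_move_def dest: bij_betw_same_card)
  qed
  have S: "finite (S vs) \<and> S vs \<subseteq> ?V \<and> card (S vs) = card D0" if "vs \<in> lists ?V" for vs
  proof -
    have sub: "P vs \<subseteq> V" using reach[OF that] reach_V by blast
    then have "bij_betw to_int (S vs) (P vs)" unfolding S_def by (rule bij_to_int)
    moreover have "finite (P vs)" using sub fin by (rule finite_subset)
    moreover have "S vs \<subseteq> ?V"
    proof
      fix p assume "p \<in> S vs"
      then have "to_int p \<in> V" using sub unfolding S_def by auto
      then show "p \<in> ?V" by (simp only: to_int_V)
    qed
    ultimately show ?thesis using reach[OF that] bij_betw_same_card bij_betw_finite by metis
  qed
  have move: "guard_move strong_adj (S vs) (S (vs @ [v])) \<and> v \<in> S (vs @ [v])" if "vs \<in> lists ?V" "v \<in> ?V" for vs v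
    using answer[of "P vs" v] reach[OF that(1)] that(2) reach_V guard_move_vimage
    unfolding S_def snoc by auto
  have "dominating ?V strong_adj (S [])"
    unfolding dominating_def
  proof (intro conjI ballI)
    show "S [] \<subseteq> ?V" using S[of "[]"] by simp
    fix v assume "v \<in> ?V"
    \<comment> \<open>The first attack may hit any v, and some guard reaches it in one move; so v is
      occupied or has a guarded neighbour at the start.\<close>
    then have "guard_move strong_adj (S []) (S [v])" "v \<in> S [v]" using move[of "[]" v] by simp_all
    then show "v \<in> S [] \<or> (\<exists>u\<in>S []. strong_adj u v)"
      unfolding guard_move_def bij_betw_def by (metis imageE)
  qed
  then have "eternal_all_win ?V strong_adj (card D0)"
    unfolding eternal_all_win_def using S move by blast
  then show ?thesis using D0(2) by blast
qed

end

theorem theorem2: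
  fixes m n :: nat
  assumes "m \<ge> 9" and "n \<ge> 9" and "m mod 7 = 2" and "n mod 7 = 2"
  shows "real (eternal_dom_all (grid_vertices m n) strong_adj)
           \<le> real (m * n) / 7 + 8 / 7 * (real m + real n - 1)"
proof -
  define a b where "a = m div 7" and "b = n div 7"
  have m: "m = 7 * a + 2" and n: "n = 7 * b + 2"
    using assms(3,4) unfolding a_def b_def by presburger+
  have "0 < a" "0 < b" using assms(1,2) m n by auto
  then interpret grid a b by unfold_locales
  obtain k where k: "k \<le> 7 * a * b + 10 * (a + b) + 4" "eternal_all_win (grid_vertices m n) strong_adj k"
    using eternal_win unfolding m n by blast
  have "eternal_dom_all (grid_vertices m n) strong_adj \<le> 7 * a * b + 10 * (a + b) + 4"
    unfolding eternal_dom_all_def using Least_le[of "eternal_all_win (grid_vertices m n) strong_adj" k] k by linarith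
  then have "real (eternal_dom_all (grid_vertices m n) strong_adj) \<le> real (7 * a * b + 10 * (a + b) + 4)"
    by (rule of_nat_mono)
  \<comment> \<open>The bound is met exactly: mn/7 = 7ab + 2(a + b) + 4/7, and the other term is 8(a
    + b) + 24/7.\<close>
  also have "\<dots> = real (m * n) / 7 + 8 / 7 * (real m + real n - 1)"
    unfolding m n by (simp add: field_simps)
  finally show ?thesis .
qed

end
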